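(* For real $a>0$, complex $t$ and $z\in\mathbb{C}$ with $\mathrm{Im}(z)>0$, define $F_3(a,t;z)$ by $$\vartheta_3\left(\pi t z,e(az)\right)=e\!\left(\Big(\frac{a}{12}-\frac{t^2}{4a}\Big)z\right)\prod_{n=1}^{\infty}\bigl(1-e(2anz)\bigr)\,F_3(a,t;z).$$ (i) If $a,t$ are positive integers with $a>t$, then, with $q=e(z)$ and $q^{\alpha}:=e(\alpha z)$, $$F_3(a,t;z)=q^{-a/12+t^2/(4a)}\exp\left(-\sum_{n=1}^{\infty}q^n\sum_{\substack{AB=n\\ B\equiv\pm(a-t)\ (\mathrm{mod}\ 2a)}}\frac{(-1)^A}{A}\right),$$ the inner sum running over pairs of positive integers $(A,B)$. (ii) With $a'=1/a$, $z'=-1/(4z)$, $t'=2tz/a$, one has $$F_3(a',t';z')=\exp\left(\frac{-i\pi t^2z}{2a}\right)F_3(a,t;z).$$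
   Context: $e(x):=e^{2\pi i x}$; $\vartheta_3(u,q)=\sum_{n=-\infty}^{\infty}q^{n^2}e^{2niu}$ for $|q|<1$. *)

theory Defs
  imports "HOL-Analysis.Analysis"
begin

definition ee :: "complex \<Rightarrow> complex" where
  "ee x = exp (2 * of_real pi * \<i> * x)"

definition theta3 :: "complex \<Rightarrow> complex \<Rightarrow> complex" where
  "theta3 u q = (\<Sum>\<^sub>\<infinity>n\<in>(UNIV::int set). q ^ nat (n^2) * exp (2 * of_int n * \<i> * u))"

definition F3 :: "real \<Rightarrow> complex \<Rightarrow> complex \<Rightarrow> complex" where
  "F3 a t z = theta3 (of_real pi * t * z) (ee (of_real a * z)) /
     (ee ((of_real a / 12 - t^2 / (4 * of_real a)) * z) *
      (\<Prod>n. (1 - ee (2 * of_real a * of_nat (Suc n) * z))))"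

definition coeffF3 :: "nat \<Rightarrow> nat \<Rightarrow> nat \<Rightarrow> complex" where
  "coeffF3 a t n = (\<Sum>A | A dvd n \<and>
      (int (n div A) mod (2 * int a) = (int a - int t) mod (2 * int a) \<or>
       int (n div A) mod (2 * int a) = (- (int a - int t)) mod (2 * int a)).
      (-1) ^ A / of_nat A)"

end

theory Submission
  imports Defs "HOL-Complex_Analysis.Complex_Analysis" "HOL-Probability.Probability" "HOL-Real_Asymp.Real_Asymp"
begin

text \<open>
  With \<open>A = 2\<pi>iaz\<close> and \<open>B = 2\<pi>itz\<close>, the theta function in the statement becomes the series
  \<open>\<Theta>(A, B) = \<Sum>n. exp (A n\<^sup>2 + B n)\<close>, and \<open>F\<^sub>3\<close> is \<open>exp (B\<^sup>2 / 4A) \<Theta>(A, B) / \<eta>(A)\<close> with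
  \<open>\<eta>(A) = exp (A / 12) \<Prod>n. (1 - exp (2An))\<close>.

  The Jacobi triple product turns \<open>\<Theta> / \<Prod>(1 - exp (2An))\<close> into a product of factors \<open>1 + q\<^sup>m\<close>, one
  for each positive \<open>m \<equiv> \<plusminus>(a - t)\<close> modulo \<open>2a\<close>; expanding the logarithms gives (i).

  For (ii), the substitution is \<open>A \<mapsto> \<pi>\<^sup>2 / A\<close>, \<open>B \<mapsto> -\<pi>iB / A\<close>. Poisson summation gives the behaviour of
  \<open>\<Theta>\<close>: for real \<open>A\<close> the Fourier coefficients of a periodised Gaussian are values of the
  characteristic function of the normal distribution, and general \<open>A\<close> follows by analytic continuation.
  The pentagonal number theorem writes \<open>\<Prod>(1 - exp (2An))\<close> as \<open>\<Theta>(3A, \<pi>i - A)\<close>, so \<open>\<eta>\<close> inherits the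
  same square root factor from \<open>\<Theta>\<close> and it cancels in the quotient.
\<close>

section \<open>Theta series\<close>

text \<open>The nome is exp A and the theta argument is B / (2i). Passing to exponents keeps
  fractional powers such as q^(1/12) free of branch choices and turns completing the square into
  plain addition.\<close>

definition theta_series :: "complex \<Rightarrow> complex \<Rightarrow> complex" where
  "theta_series A B = (\<Sum>\<^sub>\<infinity>n\<in>(UNIV::int set). exp (A * of_int n ^ 2 + B * of_int n))"

lemma summable_on_int_if_even:
  fixes f :: "int \<Rightarrow> real"
  assumes "\<And>n. f (- n) = f n" and "(\<lambda>n. f (int n)) summable_on UNIV"
  shows "f summable_on UNIV"
proof -
  have 1: "f summable_on range int"
    using assms(2) by (subst summable_on_reindex) (auto simp: o_def)
  have 2: "f summable_on range (\<lambda>n. - int n)"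
    using assms by (subst summable_on_reindex) (auto simp: o_def inj_on_def)
  have "n \<in> range int \<union> range (\<lambda>n. - int n)" for n :: int
    by (cases n rule: int_cases2) auto
  hence "UNIV = range int \<union> range (\<lambda>n. - int n)" by blast
  thus ?thesis using summable_on_union[OF 1 2] by simp
qed

text \<open>One majorant for all theta terms with Re A at most -d and |B| at most M, hence for
  absolute as well as locally uniform convergence. The absolute value on n makes it even, so only
  natural n need an estimate.\<close>

lemma summable_on_gaussian:
  fixes d M :: real
  assumes "d > 0"
  shows "(\<lambda>n::int. exp (- d * of_int n ^ 2 + M * \<bar>of_int n\<bar>)) summable_on UNIV"
proof (rule summable_on_int_if_even)
  have "(\<lambda>n::nat. exp (- d * real n ^ 2 + M * real n)) \<in> O(\<lambda>n. exp (- real n))"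
    using assms by real_asymp
  moreover have "summable (\<lambda>n. norm (exp (- real n)))"
  proof -
    have "exp (- real n) = exp (-1) ^ n" for n
      by (metis exp_of_nat_mult mult_minus1_right)
    thus ?thesis by (simp add: summable_geometric)
  qed
  ultimately have "summable (\<lambda>n. exp (- d * real n ^ 2 + M * real n))"
    by (rule summable_comparison_test_bigo[rotated])
  thus "(\<lambda>n. exp (- d * of_int (int n) ^ 2 + M * \<bar>of_int (int n)\<bar>)) summable_on UNIV"
    by (intro norm_summable_imp_summable_on) simp
qed simp

lemma norm_theta_term_le:
  assumes "Re A \<le> - d" and "norm B \<le> M"
  shows "norm (exp (A * of_int n ^ 2 + B * of_int n)) \<le> exp (- d * of_int n ^ 2 + M * \<bar>of_int n\<bar>)"
proof -
  have "Re A * of_int n ^ 2 \<le> - d * of_int n ^ 2"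
    using assms(1) by (intro mult_right_mono) auto
  moreover have "Re B * of_int n \<le> M * \<bar>of_int n\<bar>"
  proof -
    have "Re B * of_int n \<le> \<bar>Re B\<bar> * \<bar>of_int n\<bar>"
      by (metis abs_ge_self abs_mult)
    also have "\<dots> \<le> M * \<bar>of_int n\<bar>"
      using assms(2) abs_Re_le_cmod[of B] by (intro mult_right_mono) auto
    finally show ?thesis .
  qed
  ultimately show ?thesis
    by (simp flip: of_int_power)
qed

lemma abs_summable_theta:
  assumes "Re A < 0"
  shows "(\<lambda>n::int. norm (exp (A * of_int n ^ 2 + B * of_int n))) summable_on UNIV"
  by (rule Infinite_Sum.abs_summable_on_comparison_test'
      [OF summable_on_gaussian[of "- Re A" "norm B"] norm_theta_term_le]) (use assms in auto)

lemma has_sum_theta: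
  assumes "Re A < 0"
  shows "((\<lambda>n::int. exp (A * of_int n ^ 2 + B * of_int n)) has_sum theta_series A B) UNIV"
  unfolding theta_series_def
  using abs_summable_summable[OF abs_summable_theta[OF assms]] by (rule has_sum_infsum)

lemma uniform_limit_theta:
  assumes "d > 0" and "\<And>s. s \<in> Y \<Longrightarrow> Re (A s) \<le> - d" and "\<And>s. s \<in> Y \<Longrightarrow> norm (B s) \<le> M"
  shows "uniform_limit Y (\<lambda>X s. \<Sum>n\<in>X. exp (A s * of_int n ^ 2 + B s * of_int n))
           (\<lambda>s. theta_series (A s) (B s)) (finite_subsets_at_top UNIV)"
  unfolding theta_series_def
  using assms by (intro Weierstrass_m_test_general[OF _ summable_on_gaussian[OF assms(1), of M]]
      norm_theta_term_le) auto

text \<open>A locally uniform limit of finite sums of holomorphic functions is holomorphic. Both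
  arguments may vary with s: the continuation of the inversion formula moves A and the second
  argument together, while continuity in x moves only the latter.\<close>

lemma holomorphic_on_theta_series:
  assumes hA: "A holomorphic_on S" and hB: "B holomorphic_on S" and "open S"
    and neg: "\<And>s. s \<in> S \<Longrightarrow> Re (A s) < 0"
  shows "(\<lambda>s. theta_series (A s) (B s)) holomorphic_on S"
proof -
  have "\<exists>r>0. (\<lambda>s. theta_series (A s) (B s)) holomorphic_on ball z r" if "z \<in> S" for z
  proof -
    obtain r where r: "r > 0" "cball z r \<subseteq> S"
      using \<open>open S\<close> \<open>z \<in> S\<close> open_contains_cball by blast
    have cA: "continuous_on (cball z r) A" and cB: "continuous_on (cball z r) B"
      using hA hB r holomorphic_on_imp_continuous_on continuous_on_subset by blast+
    \<comment> \<open>The maximum of Re A on the closed disc is attained and is therefore still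
      negative; this supplies the uniform decay rate d.\<close>
    have "compact ((\<lambda>s. Re (A s)) ` cball z r)"
      by (intro compact_continuous_image continuous_intros cA compact_cball)
    moreover have "(\<lambda>s. Re (A s)) ` cball z r \<noteq> {}" using r by auto
    ultimately obtain x0 where x0: "x0 \<in> cball z r" "\<And>s. s \<in> cball z r \<Longrightarrow> Re (A s) \<le> Re (A x0)"
      using compact_attains_sup[of "(\<lambda>s. Re (A s)) ` cball z r"] by auto
    have "bounded (B ` cball z r)"
      by (intro compact_imp_bounded compact_continuous_image cB compact_cball)
    then obtain M where M: "\<And>s. s \<in> cball z r \<Longrightarrow> norm (B s) \<le> M"
      unfolding bounded_iff by blast
    have "Re (A x0) < 0" using neg x0 r by blast
    hence lim: "uniform_limit (cball z r) (\<lambda>X s. \<Sum>n\<in>X. exp (A s * of_int n ^ 2 + B s * of_int n))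
           (\<lambda>s. theta_series (A s) (B s)) (finite_subsets_at_top UNIV)"
      using x0 M by (intro uniform_limit_theta[of "- Re (A x0)" _ _ _ M]) auto
    have hol: "A holomorphic_on ball z r" "B holomorphic_on ball z r"
      using hA hB r ball_subset_cball holomorphic_on_subset by (meson order_trans)+
    have "\<forall>\<^sub>F X in finite_subsets_at_top (UNIV::int set).
        continuous_on (cball z r) (\<lambda>s. \<Sum>n\<in>X. exp (A s * of_int n ^ 2 + B s * of_int n)) \<and>
        (\<lambda>s. \<Sum>n\<in>X. exp (A s * of_int n ^ 2 + B s * of_int n)) holomorphic_on ball z r"
      by (intro always_eventually allI conjI continuous_intros holomorphic_intros cA cB hol)
    from holomorphic_uniform_limit[OF this lim] r show ?thesis by auto
  qed
  hence "(\<lambda>s. theta_series (A s) (B s)) analytic_on S"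
    unfolding analytic_on_def by blast
  thus ?thesis using analytic_imp_holomorphic by blast
qed

lemma theta_series_minus: "theta_series A (- B) = theta_series A B"
  unfolding theta_series_def
  by (rule infsum_reindex_bij_witness[of _ uminus uminus]) auto

section \<open>The Jacobi triple product\<close>

text \<open>With q = exp A this is the q-Pochhammer symbol (q^2; q^2)_n, and
  \<open>euler_prod\<close> is its limit (q^2; q^2)_infinity.\<close>

definition qfac :: "complex \<Rightarrow> nat \<Rightarrow> complex" where
  "qfac A n = (\<Prod>k<n. 1 - exp (2 * A * of_nat (Suc k)))"

definition euler_prod :: "complex \<Rightarrow> complex" where
  "euler_prod A = (\<Prod>k. 1 - exp (2 * A * of_nat (Suc k)))"

text \<open>
  The value 0 at negative arguments keeps \<open>inv_qfac_pred\<close> valid at every integer, so the recurrence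
  for the coefficients of the finite triple product needs no boundary cases.
\<close>

definition inv_qfac :: "complex \<Rightarrow> int \<Rightarrow> complex" where
  "inv_qfac A j = (if j < 0 then 0 else 1 / qfac A (nat j))"

lemma exp_neq_1_if_Re_neg:
  assumes "Re z < 0"
  shows "exp z \<noteq> (1 :: complex)"
proof
  assume "exp z = 1"
  hence "norm (exp z) = 1" by simp
  thus False using assms by simp
qed

lemma euler_factor_nonzero:
  assumes "Re A < 0"
  shows "1 - exp (2 * A * of_nat (Suc k)) \<noteq> 0"
  using exp_neq_1_if_Re_neg[of "2 * A * of_nat (Suc k)"] assms
  by (simp add: mult_neg_pos del: of_nat_Suc)

lemma summable_norm_exp_mult_of_nat:
  assumes "Re A < 0"
  shows "summable (\<lambda>k. norm (exp (A * of_nat k)))"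
proof -
  have "norm (exp (A * of_nat k)) = norm (exp A) ^ k" for k
    by (simp add: norm_power mult.commute flip: exp_of_nat_mult)
  moreover have "norm (exp A) < 1" using assms by simp
  ultimately show ?thesis by (simp add: summable_geometric del: norm_exp_eq_Re)
qed

lemma convergent_euler_prod:
  assumes "Re A < 0"
  shows "convergent_prod (\<lambda>k. 1 - exp (2 * A * of_nat (Suc k)))"
proof (rule abs_convergent_prod_imp_convergent_prod)
  have "summable (\<lambda>k. norm (exp ((2 * A) * of_nat (Suc k))))"
    using summable_norm_exp_mult_of_nat[of "2 * A"] assms by (subst summable_Suc_iff) auto
  thus "abs_convergent_prod (\<lambda>k. 1 - exp (2 * A * of_nat (Suc k)))"
    unfolding abs_convergent_prod_conv_summable by (simp del: of_nat_Suc norm_exp_eq_Re)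
qed

lemma euler_prod_nonzero: "Re A < 0 \<Longrightarrow> euler_prod A \<noteq> 0"
  unfolding euler_prod_def
  using convergent_euler_prod euler_factor_nonzero by (intro prodinf_nonzero) auto

lemma qfac_tendsto: 
  assumes "Re A < 0"
  shows "qfac A \<longlonglongrightarrow> euler_prod A"
  using convergent_prod_LIMSEQ[OF convergent_euler_prod[OF assms]]
  unfolding euler_prod_def qfac_def[abs_def] lessThan_Suc_atMost[symmetric]
  by (rule LIMSEQ_imp_Suc)

lemma inv_qfac_pred:
  assumes "Re A < 0"
  shows "inv_qfac A (j - 1) = inv_qfac A j * (1 - exp (2 * A * of_int j))"
proof (cases "j \<le> 0")
  case True
  thus ?thesis by (cases "j = 0") (auto simp: inv_qfac_def)
next
  case False
  then obtain n where j: "j = int (Suc n)" by (metis not_le pos_int_cases Suc_pred)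
  have "nat j = Suc n" "nat (j - 1) = n" "\<not> j < 0" "\<not> j - 1 < 0" using j by auto
  hence "inv_qfac A j = 1 / (qfac A n * (1 - exp (2 * A * of_int j)))"
    unfolding inv_qfac_def using j by (simp add: qfac_def)
  moreover have "1 - exp (2 * A * of_int j) \<noteq> 0"
    using euler_factor_nonzero[OF assms, of n] j by simp
  ultimately show ?thesis
    using j \<open>nat (j - 1) = n\<close> by (simp add: inv_qfac_def)
qed

text \<open>With q = exp A and w = exp B this is the Gaussian binomial coefficient of 2N over N + n
  in base q^2, times q^(n^2) w^n: the term of degree n in w of the finite triple product. It
  vanishes for |n| > N.\<close>

definition jtp_coeff :: "complex \<Rightarrow> complex \<Rightarrow> nat \<Rightarrow> int \<Rightarrow> complex" where
  "jtp_coeff A B N n = qfac A (2 * N) * inv_qfac A (int N + n) * inv_qfac A (int N - n) *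
     exp (A * of_int n ^ 2 + B * of_int n)"

text \<open>The new pair of factors expands as (1 + q^(2N+1) w)(1 + q^(2N+1) / w) = 1 + q^(4N+2) +
  q^(2N+1) w + q^(2N+1) / w, and the recurrence compares terms of degree n in w. It reduces to a
  polynomial identity in q, q^N, q^n and q^(-n).\<close>

lemma jtp_coeff_Suc:
  assumes "Re A < 0"
  shows "jtp_coeff A B (Suc N) n =
    (1 + exp (2 * A * (2 * of_nat N + 1))) * jtp_coeff A B N n +
    exp (A * (2 * of_nat N + 1) + B) * jtp_coeff A B N (n - 1) +
    exp (A * (2 * of_nat N + 1) - B) * jtp_coeff A B N (n + 1)"
proof -
  \<comment> \<open>J and K are the largest indices that occur. Every other \<open>inv_qfac\<close>
    is reached from them by stepping down, which multiplies by a polynomial factor, so no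
    denominators appear.\<close>
  define J K where "J = int (Suc N) + n" and "K = int (Suc N) - n"
  define q X Xi Y W where "q = exp A" and "X = exp (A * of_int n)" and "Xi = exp (- (A * of_int n))"
    and "Y = exp (A * of_nat N)" and "W = exp (A * of_int n ^ 2 + B * of_int n)"
  define p r s where "p = qfac A (2 * N)" and "r = inv_qfac A J" and "s = inv_qfac A K"
  have XXi: "X * Xi = 1" unfolding X_def Xi_def by (simp flip: exp_add)
  have p: "qfac A (2 * Suc N) = p * (1 - Y ^ 4 * q ^ 2) * (1 - Y ^ 4 * q ^ 4)"
  proof -
    have "exp (2 * A * of_nat (Suc (2 * N))) = Y ^ 4 * q ^ 2"
      unfolding Y_def q_def by (simp add: algebra_simps flip: exp_add exp_of_nat_mult)
    moreover have "exp (2 * A * of_nat (Suc (Suc (2 * N)))) = Y ^ 4 * q ^ 4"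
      unfolding Y_def q_def by (simp add: algebra_simps flip: exp_add exp_of_nat_mult)
    ultimately show ?thesis by (simp add: qfac_def p_def del: of_nat_Suc)
  qed
  have eJ: "exp (2 * A * of_int J) = Y ^ 2 * X ^ 2 * q ^ 2"
    unfolding Y_def q_def X_def J_def by (simp add: algebra_simps flip: exp_add exp_of_nat_mult)
  have eK: "exp (2 * A * of_int K) = Y ^ 2 * Xi ^ 2 * q ^ 2"
    unfolding Y_def q_def Xi_def K_def by (simp add: algebra_simps flip: exp_add exp_of_nat_mult)
  have eJ1: "exp (2 * A * of_int (J - 1)) = Y ^ 2 * X ^ 2"
    unfolding Y_def q_def X_def J_def by (simp add: algebra_simps flip: exp_add exp_of_nat_mult)
  have eK1: "exp (2 * A * of_int (K - 1)) = Y ^ 2 * Xi ^ 2"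
    unfolding Y_def q_def Xi_def K_def by (simp add: algebra_simps flip: exp_add exp_of_nat_mult)
  have r1: "inv_qfac A (J - 1) = r * (1 - Y ^ 2 * X ^ 2 * q ^ 2)"
    unfolding r_def inv_qfac_pred[OF assms, of J] eJ ..
  have s1: "inv_qfac A (K - 1) = s * (1 - Y ^ 2 * Xi ^ 2 * q ^ 2)"
    unfolding s_def inv_qfac_pred[OF assms, of K] eK ..
  have r2: "inv_qfac A (J - 1 - 1) = r * (1 - Y ^ 2 * X ^ 2 * q ^ 2) * (1 - Y ^ 2 * X ^ 2)"
    unfolding inv_qfac_pred[OF assms, of "J - 1"] eJ1 r1 ..
  have s2: "inv_qfac A (K - 1 - 1) = s * (1 - Y ^ 2 * Xi ^ 2 * q ^ 2) * (1 - Y ^ 2 * Xi ^ 2)"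
    unfolding inv_qfac_pred[OF assms, of "K - 1"] eK1 s1 ..
  have c0: "jtp_coeff A B N n = p * (r * (1 - Y ^ 2 * X ^ 2 * q ^ 2)) * (s * (1 - Y ^ 2 * Xi ^ 2 * q ^ 2)) * W"
    unfolding jtp_coeff_def p_def[symmetric] W_def[symmetric] r1[symmetric] s1[symmetric] J_def K_def
    by (simp add: algebra_simps)
  have "int N + (n - 1) = J - 1 - 1" "int N - (n - 1) = K"
    "int N + (n + 1) = J" "int N - (n + 1) = K - 1 - 1" unfolding J_def K_def by auto
  note idx = this
  have "exp (A * (2 * of_nat N + 1) + B) * exp (A * of_int (n - 1) ^ 2 + B * of_int (n - 1)) = Y ^ 2 * q ^ 2 * Xi ^ 2 * W"
    unfolding Y_def q_def Xi_def W_def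
    by (simp add: algebra_simps power2_eq_square flip: exp_add exp_of_nat_mult)
  hence c1: "exp (A * (2 * of_nat N + 1) + B) * jtp_coeff A B N (n - 1) =
      p * (r * (1 - Y ^ 2 * X ^ 2 * q ^ 2) * (1 - Y ^ 2 * X ^ 2)) * s * (Y ^ 2 * q ^ 2 * Xi ^ 2 * W)"
    unfolding jtp_coeff_def p_def[symmetric] idx r2 s_def[symmetric] by (simp add: mult_ac)
  have "exp (A * (2 * of_nat N + 1) - B) * exp (A * of_int (n + 1) ^ 2 + B * of_int (n + 1)) = Y ^ 2 * q ^ 2 * X ^ 2 * W"
    unfolding Y_def q_def X_def W_def
    by (simp add: algebra_simps power2_eq_square flip: exp_add exp_of_nat_mult)
  hence c2: "exp (A * (2 * of_nat N + 1) - B) * jtp_coeff A B N (n + 1) =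
      p * r * (s * (1 - Y ^ 2 * Xi ^ 2 * q ^ 2) * (1 - Y ^ 2 * Xi ^ 2)) * (Y ^ 2 * q ^ 2 * X ^ 2 * W)"
    unfolding jtp_coeff_def p_def[symmetric] idx s2 r_def[symmetric] by (simp add: mult_ac)
  have c3: "exp (2 * A * (2 * of_nat N + 1)) = Y ^ 4 * q ^ 2"
    unfolding Y_def q_def by (simp add: algebra_simps flip: exp_add exp_of_nat_mult)
  have c4: "jtp_coeff A B (Suc N) n = p * (1 - Y ^ 4 * q ^ 2) * (1 - Y ^ 4 * q ^ 4) * r * s * W"
    unfolding jtp_coeff_def p J_def[symmetric] K_def[symmetric] r_def[symmetric] s_def[symmetric]
      W_def[symmetric] ..
  show ?thesis unfolding c0 c1 c2 c3 c4
    using XXi by algebra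
qed

text \<open>Finite form of the triple product, by induction with \<open>jtp_coeff_Suc\<close>.
  Summing over all integers instead of -N..N makes the index shifts in the recurrence bijections of
  the index set.\<close>

lemma has_sum_jtp_coeff:
  assumes "Re A < 0"
  shows "(jtp_coeff A B N has_sum
    (\<Prod>k<N. (1 + exp (A * (2 * of_nat k + 1) + B)) * (1 + exp (A * (2 * of_nat k + 1) - B)))) UNIV"
proof (induction N)
  case 0
  have "jtp_coeff A B 0 n = 0" if "n \<noteq> 0" for n
    using that by (auto simp: jtp_coeff_def inv_qfac_def)
  moreover have "jtp_coeff A B 0 0 = 1"
    by (simp add: jtp_coeff_def inv_qfac_def qfac_def)
  ultimately show ?case
    by (intro has_sum_finite_neutralI[of "{0}"]) auto
next
  case (Suc N)
  define P where "P = (\<Prod>k<N. (1 + exp (A * (2 * of_nat k + 1) + B)) * (1 + exp (A * (2 * of_nat k + 1) - B)))"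
  have *: "((\<lambda>n. jtp_coeff A B N (n + c)) has_sum P) UNIV" for c
    using Suc.IH unfolding P_def
    by (subst has_sum_reindex_bij_witness[of _ "\<lambda>n. n - c" "\<lambda>n. n + c" _ "jtp_coeff A B N"]) auto
  have "((\<lambda>n. (1 + exp (2 * A * (2 * of_nat N + 1))) * jtp_coeff A B N n +
    exp (A * (2 * of_nat N + 1) + B) * jtp_coeff A B N (n - 1) +
    exp (A * (2 * of_nat N + 1) - B) * jtp_coeff A B N (n + 1)) has_sum
    ((1 + exp (2 * A * (2 * of_nat N + 1))) * P + exp (A * (2 * of_nat N + 1) + B) * P +
      exp (A * (2 * of_nat N + 1) - B) * P)) UNIV"
    using *[of 0] *[of 1] *[of "-1"] by (intro has_sum_add has_sum_cmult_right) auto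
  also have "(1 + exp (2 * A * (2 * of_nat N + 1))) * P + exp (A * (2 * of_nat N + 1) + B) * P +
      exp (A * (2 * of_nat N + 1) - B) * P =
      P * ((1 + exp (A * (2 * of_nat N + 1) + B)) * (1 + exp (A * (2 * of_nat N + 1) - B)))"
    by (simp add: algebra_simps flip: exp_add)
  finally show ?case
    by (simp add: P_def jtp_coeff_Suc[OF assms, abs_def])
qed

text \<open>Tannery's theorem applied to the finite identity: each coefficient tends to its theta
  term divided by \<open>euler_prod A\<close>, and the terms are dominated uniformly in N by a
  constant multiple of the theta terms.\<close>

theorem jacobi_triple_product:
  assumes "Re A < 0"
  shows "(\<lambda>N. \<Prod>k<N. (1 + exp (A * (2 * of_nat k + 1) + B)) * (1 + exp (A * (2 * of_nat k + 1) - B)))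
    \<longlonglongrightarrow> theta_series A B / euler_prod A"
proof -
  note lim = qfac_tendsto[OF assms] and nz = euler_prod_nonzero[OF assms]
  let ?W = "\<lambda>n::int. exp (A * of_int n ^ 2 + B * of_int n)"
  obtain C where C: "\<And>n. norm (qfac A n) \<le> C"
    using convergent_imp_bounded[OF lim] unfolding bounded_iff by auto
  \<comment> \<open>The reciprocals are bounded because they converge, the limit of
    \<open>qfac A\<close> being nonzero.\<close>
  have "(\<lambda>n. 1 / qfac A n) \<longlonglongrightarrow> 1 / euler_prod A"
    using nz by (intro tendsto_intros lim)
  from convergent_imp_bounded[OF this] obtain D where D: "\<And>n. norm (1 / qfac A n) \<le> D"
    unfolding bounded_iff by auto
  have D0: "D \<ge> 0" and C0: "C \<ge> 0" using D[of 0] C[of 0] norm_ge_zero order_trans by blast+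
  have D': "norm (inv_qfac A j) \<le> D" for j
    using D D0 by (auto simp: inv_qfac_def)
  have ub: "norm (jtp_coeff A B N n) \<le> C * D * D * norm (?W n)" for N n
    unfolding jtp_coeff_def norm_mult using C D' D0 C0 by (intro mult_mono mult_nonneg_nonneg) auto
  have unif: "uniform_limit UNIV (\<lambda>X N. \<Sum>n\<in>X. jtp_coeff A B N n)
    (\<lambda>N. \<Prod>k<N. (1 + exp (A * (2 * of_nat k + 1) + B)) * (1 + exp (A * (2 * of_nat k + 1) - B)))
    (finite_subsets_at_top UNIV)"
    by (rule Weierstrass_m_test_general'[OF ub has_sum_jtp_coeff[OF assms]])
       (intro summable_on_cmult_right abs_summable_theta assms)
  have shift: "(\<lambda>N. inv_qfac A (int N + n)) \<longlonglongrightarrow> 1 / euler_prod A" for n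
  proof -
    have fl: "filterlim (\<lambda>N. nat (int N + n)) at_top at_top"
      unfolding filterlim_at_top
    proof
      fix m :: nat
      show "\<forall>\<^sub>F N in sequentially. m \<le> nat (int N + n)"
        using eventually_ge_at_top[of "m + nat (\<bar>n\<bar>)"] by eventually_elim linarith
    qed
    have "(\<lambda>N. 1 / qfac A (nat (int N + n))) \<longlonglongrightarrow> 1 / euler_prod A"
      using nz by (intro tendsto_intros filterlim_compose[OF lim fl])
    moreover have "\<forall>\<^sub>F N in sequentially. 1 / qfac A (nat (int N + n)) = inv_qfac A (int N + n)"
      using eventually_ge_at_top[of "nat (\<bar>n\<bar>)"] by eventually_elim (auto simp: inv_qfac_def)
    ultimately show ?thesis by (rule Lim_transform_eventually)
  qed
  have "filterlim (\<lambda>N::nat. 2 * N) at_top at_top"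
    by real_asymp
  hence lim2: "(\<lambda>N. qfac A (2 * N)) \<longlonglongrightarrow> euler_prod A"
    by (rule filterlim_compose[OF lim])
  have "(\<lambda>N. jtp_coeff A B N n) \<longlonglongrightarrow> euler_prod A * (1 / euler_prod A) * (1 / euler_prod A) * ?W n" for n
    unfolding jtp_coeff_def using shift[of "- n"] by (intro tendsto_mult lim2 shift tendsto_const) auto
  hence termlim: "(\<lambda>N. \<Sum>n\<in>X. jtp_coeff A B N n) \<longlonglongrightarrow> (\<Sum>n\<in>X. ?W n / euler_prod A)" for X
    using nz by (intro tendsto_sum) simp
  have "((\<lambda>n. ?W n / euler_prod A) has_sum theta_series A B / euler_prod A) UNIV"
    using has_sum_cmult_left[OF has_sum_theta[OF assms, of B], of "1 / euler_prod A"] by simp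
  hence "((\<lambda>X. \<Sum>n\<in>X. ?W n / euler_prod A) \<longlongrightarrow> theta_series A B / euler_prod A) (finite_subsets_at_top UNIV)"
    unfolding has_sum_def .
  \<comment> \<open>Uniformity in N of the sum over n allows the limit in N to be taken term by
    term.\<close>
  from swap_uniform_limit'[OF _ this unif, of sequentially] termlim show ?thesis
    by auto
qed

section \<open>Uniqueness of Fourier coefficients\<close>

text \<open>On the unit circle the conjugate of w is 1 / w, so Re w and Im w, and hence all real
  polynomials in them, are Laurent polynomials in w. This converts Stone-Weierstrass approximants
  into trigonometric polynomials.\<close>

lemma real_polynomial_on_circle:
  fixes f :: "complex \<Rightarrow> real"
  assumes "real_polynomial_function f"
  shows "\<exists>p N. \<forall>w\<in>sphere 0 1. complex_of_real (f w) = poly p w / w ^ N"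
  using assms
proof (induction rule: real_polynomial_function.induct)
  case (linear f)
  interpret bounded_linear f by fact
  \<comment> \<open>The numerator is w times f(1) (w + 1/w) / 2 + f(i) (w - 1/w) / (2i).\<close>
  have "complex_of_real (f w) = poly [:(f 1 + \<i> * f \<i>) / 2, 0, (f 1 - \<i> * f \<i>) / 2:] w / w ^ 1" if "w \<in> sphere 0 1" for w
  proof -
    have w: "w * cnj w = 1" "w \<noteq> 0" using that by (auto simp flip: complex_norm_square)
    have "f w = f (Re w *\<^sub>R 1 + Im w *\<^sub>R \<i>)"
      by (rule arg_cong[of _ _ f]) (simp add: complex_eq_iff)
    also have "\<dots> = Re w * f 1 + Im w * f \<i>" by (simp only: add scaleR real_scaleR_def)
    finally have "complex_of_real (f w) = complex_of_real (Re w) * complex_of_real (f 1) +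
        complex_of_real (Im w) * complex_of_real (f \<i>)" by simp
    also have "complex_of_real (Re w) = (w + cnj w) / 2" by (simp add: complex_add_cnj)
    also have "complex_of_real (Im w) = - \<i> * (w - cnj w) / 2" by (simp add: complex_eq_iff)
    also have "cnj w = 1 / w" using w by (simp add: field_simps)
    finally have eq: "complex_of_real (f w) = (w + 1 / w) / 2 * complex_of_real (f 1) +
        - \<i> * (w - 1 / w) / 2 * complex_of_real (f \<i>)" .
    show ?thesis unfolding eq using w(2) by (simp add: field_simps power2_eq_square)
  qed
  thus ?case by blast
next
  case (const c)
  show ?case by (rule exI[of _ "[:of_real c:]"], rule exI[of _ 0]) simp
next
  case (add f g)
  then obtain p N q M where *: "\<forall>w\<in>sphere 0 1. complex_of_real (f w) = poly p w / w ^ N"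
    "\<forall>w\<in>sphere 0 1. complex_of_real (g w) = poly q w / w ^ M" by blast
  have "complex_of_real (f w + g w) = poly (p * monom 1 M + q * monom 1 N) w / w ^ (N + M)"
    if "w \<in> sphere 0 1" for w
  proof -
    have "w \<noteq> 0" using that by auto
    thus ?thesis using * that by (simp add: poly_monom field_simps power_add)
  qed
  thus ?case by blast
next
  case (mult f g)
  then obtain p N q M where *: "\<forall>w\<in>sphere 0 1. complex_of_real (f w) = poly p w / w ^ N"
    "\<forall>w\<in>sphere 0 1. complex_of_real (g w) = poly q w / w ^ M" by blast
  have "complex_of_real (f w * g w) = poly (p * q) w / w ^ (N + M)"
    if "w \<in> sphere 0 1" for w
    using * that by (simp add: power_add)
  thus ?case by blast
qed

lemma polynomial_function_on_circle:
  fixes f :: "complex \<Rightarrow> complex"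
  assumes "polynomial_function f"
  shows "\<exists>p N. \<forall>w\<in>sphere 0 1. f w = poly p w / w ^ N"
proof -
  have "real_polynomial_function (Re \<circ> f)" "real_polynomial_function (Im \<circ> f)"
    using assms bounded_linear_Re bounded_linear_Im unfolding polynomial_function_def by blast+
  then obtain p N q M where *: "\<forall>w\<in>sphere 0 1. complex_of_real (Re (f w)) = poly p w / w ^ N"
    "\<forall>w\<in>sphere 0 1. complex_of_real (Im (f w)) = poly q w / w ^ M"
    using real_polynomial_on_circle[of "Re \<circ> f"] real_polynomial_on_circle[of "Im \<circ> f"] by auto
  have "f w = poly (p * monom 1 M + smult \<i> q * monom 1 N) w / w ^ (N + M)"
    if "w \<in> sphere 0 1" for w
  proof -
    have "w \<noteq> 0" using that by auto
    have "f w = of_real (Re (f w)) + \<i> * of_real (Im (f w))" by (rule complex_eq)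
    thus ?thesis using * that \<open>w \<noteq> 0\<close> by (simp add: poly_monom field_simps power_add)
  qed
  thus ?thesis by blast
qed

lemma periodic_of_int:
  fixes h :: "real \<Rightarrow> 'a"
  assumes per: "\<And>x. h (x + 1) = h x"
  shows "h (x + of_int k) = h x"
proof (induction k rule: int_induct[of _ 0])
  case (step1 i)
  thus ?case using per[of "x + of_int i"] by (simp add: add.assoc)
next
  case (step2 i)
  thus ?case using per[of "x + of_int (i - 1)"] by (simp add: add.assoc)
qed simp

lemma periodic_cis_eq:
  fixes h :: "real \<Rightarrow> 'a"
  assumes per: "\<And>x. h (x + 1) = h x" and eq: "cis (2 * pi * x) = cis (2 * pi * y)"
  shows "h x = h y"
proof -
  have "exp (\<i> * of_real (2 * pi * x)) = exp (\<i> * of_real (2 * pi * y))"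
    using eq by (simp add: cis_conv_exp)
  then obtain n :: int where "\<i> * of_real (2 * pi * x) = \<i> * of_real (2 * pi * y) + of_int (2 * n) * of_real pi * \<i>"
    unfolding exp_eq by auto
  hence "Im (\<i> * of_real (2 * pi * x)) = Im (\<i> * of_real (2 * pi * y) + of_int (2 * n) * of_real pi * \<i>)" by simp
  hence "2 * pi * x = 2 * pi * (y + of_int n)" by (simp add: algebra_simps)
  hence "x = y + of_int n" by simp
  thus ?thesis using periodic_of_int[of h y n, OF per] by simp
qed

text \<open>F is h composed with Arg / (2 pi). The only possible discontinuity lies on the cut of
  Arg, where the jump of 2 pi is a full period of h.\<close>

lemma periodic_factors_through_circle:
  fixes h :: "real \<Rightarrow> 'a :: topological_space"
  assumes cont: "continuous_on UNIV h" and per: "\<And>x. h (x + 1) = h x"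
  obtains F where "continuous_on (sphere 0 1) F" "\<And>x. F (cis (2 * pi * x)) = h x"
proof -
  define F where "F = (\<lambda>w. h (Arg w / (2 * pi)))"
  have eq: "F w = h x" if "cis (2 * pi * x) = w" for w x
  proof -
    have "cis (Arg w) = w" using cis_Arg[of w] that
      by (metis cis_neq_zero norm_cis sgn_eq div_by_1 of_real_1)
    thus ?thesis unfolding F_def using that
      by (intro periodic_cis_eq[of h, OF per]) simp
  qed
  have "continuous (at w within sphere 0 1) F" if w: "w \<in> sphere 0 1" for w
  proof (cases "w \<in> \<real>\<^sub>\<le>\<^sub>0")
    case False
    have "isCont h x" for x using cont continuous_on_eq_continuous_at by blast
    moreover have "isCont (\<lambda>w. Arg w / (2 * pi)) w"
      using False by (intro isCont_divide continuous_at_Arg continuous_const) auto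
    ultimately have "isCont F w"
      unfolding F_def by (intro isCont_o2[of w "\<lambda>w. Arg w / (2 * pi)" h]) blast+
    thus ?thesis by (rule continuous_at_imp_continuous_within)
  next
    case True
    hence nm: "- w \<notin> \<real>\<^sub>\<le>\<^sub>0" using w by (auto simp: complex_nonpos_Reals_iff cmod_def)
    \<comment> \<open>Arg (-w) + pi is a branch of the argument continuous near -1. On the circle G
      agrees with F by periodicity, so F inherits its continuity.\<close>
    define G where "G = (\<lambda>w. h ((Arg (- w) + pi) / (2 * pi)))"
    have "isCont h x" for x using cont continuous_on_eq_continuous_at by blast
    moreover have "isCont (\<lambda>w. Arg (- w)) w"
      using nm by (intro isCont_o2[of w uminus Arg] continuous_at_Arg continuous_minus continuous_ident)
    hence "isCont (\<lambda>w. (Arg (- w) + pi) / (2 * pi)) w"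
      by (intro isCont_divide isCont_add continuous_const) auto
    ultimately have "isCont G w"
      unfolding G_def by (intro isCont_o2[of w "\<lambda>w. (Arg (- w) + pi) / (2 * pi)" h]) blast+
    moreover have "G v = F v" if "v \<in> sphere 0 1" for v
    proof -
      have "cis (Arg (- v) + pi) = v"
        using that cis_Arg[of "- v"] by (cases "v = 0") (auto simp: sgn_eq simp flip: cis_mult)
      thus ?thesis unfolding G_def by (intro eq[symmetric]) simp
    qed
    ultimately show ?thesis
      using w by (intro continuous_transform_within[of w "sphere 0 1" G 1 F])
        (auto intro: continuous_at_imp_continuous_within)
  qed
  hence "continuous_on (sphere 0 1) F"
    by (simp add: continuous_on_eq_continuous_within)
  thus ?thesis using eq that by blast
qed

text \<open>Approximate the conjugate of h within e by a trigonometric polynomial G. By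
  orthogonality h G integrates to 0, so the integral of |h|^2 equals that of h (cnj h - G) and is at
  most M e. Thus |h|^2 integrates to 0, and continuity forces h to vanish at 0.\<close>

theorem fourier_uniqueness:
  fixes h :: "real \<Rightarrow> complex"
  assumes cont: "continuous_on UNIV h" and per: "\<And>x. h (x + 1) = h x"
    and orth: "\<And>k::int. integral {0..1} (\<lambda>x. h x * cis (2 * pi * k * x)) = 0"
  shows "h 0 = 0"
proof -
  obtain F where F: "continuous_on (sphere 0 1) F" "\<And>x. F (cis (2 * pi * x)) = h x"
    using periodic_factors_through_circle[OF cont per] by blast
  have conth: "continuous_on {0..1} h" using cont continuous_on_subset by blast
  have "bounded (h ` {0..1})"
    by (intro compact_imp_bounded compact_continuous_image conth) auto
  then obtain M where M: "M > 0" "\<And>x. x \<in> {0..1} \<Longrightarrow> norm (h x) \<le> M"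
    unfolding bounded_pos by auto
  define I where "I = integral {0..1} (\<lambda>x. (norm (h x))\<^sup>2)"
  have small: "I \<le> M * e" if "e > 0" for e
  proof -
    have "continuous_on (sphere 0 1) (\<lambda>w. cnj (F w))"
      by (intro continuous_intros F)
    from Stone_Weierstrass_polynomial_function[OF compact_sphere this \<open>e > 0\<close>]
    obtain g where g: "polynomial_function g" "\<And>w. w \<in> sphere 0 1 \<Longrightarrow> norm (cnj (F w) - g w) < e" by blast
    obtain p N where p: "\<And>w. w \<in> sphere 0 1 \<Longrightarrow> g w = poly p w / w ^ N"
      using polynomial_function_on_circle[OF g(1)] by blast
    define G where "G = (\<lambda>x. g (cis (2 * pi * x)))"
    have G: "G x = (\<Sum>j\<le>degree p. coeff p j * cis (2 * pi * of_int (int j - int N) * x))" for x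
    proof -
      have "G x = (\<Sum>j\<le>degree p. coeff p j * cis (2 * pi * x) ^ j / cis (2 * pi * x) ^ N)"
        unfolding G_def by (subst p) (simp_all add: poly_altdef sum_divide_distrib)
      also have "\<dots> = (\<Sum>j\<le>degree p. coeff p j * cis (2 * pi * of_int (int j - int N) * x))"
        by (intro sum.cong refl, simp only: Complex.DeMoivre times_divide_eq_right[symmetric] cis_divide)
           (simp add: algebra_simps)
      finally show ?thesis .
    qed
    have contG: "continuous_on {0..1} G" unfolding G by (intro continuous_intros)
    have "integral {0..1} (\<lambda>x. h x * G x) =
        integral {0..1} (\<lambda>x. \<Sum>j\<le>degree p. coeff p j * (h x * cis (2 * pi * of_int (int j - int N) * x)))"
      unfolding G by (simp add: sum_distrib_left mult_ac)
    also have "\<dots> = (\<Sum>j\<le>degree p. integral {0..1} (\<lambda>x. coeff p j * (h x * cis (2 * pi * of_int (int j - int N) * x))))"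
      by (intro integral_sum integrable_continuous_interval continuous_intros conth) auto
    also have "\<dots> = 0" using orth[of "int j - int N" for j] by (simp del: of_int_diff)
    finally have 0: "integral {0..1} (\<lambda>x. h x * G x) = 0" .
    have "complex_of_real I = integral {0..1} (\<lambda>x. complex_of_real ((norm (h x))\<^sup>2))"
      unfolding I_def
      by (rule integral_linear[OF _ bounded_linear_of_real, unfolded o_def, symmetric])
         (intro integrable_continuous_interval continuous_intros conth)
    also have "\<dots> = integral {0..1} (\<lambda>x. h x * cnj (h x))"
      by (simp only: complex_norm_square)
    also have "\<dots> = integral {0..1} (\<lambda>x. h x * cnj (h x)) - integral {0..1} (\<lambda>x. h x * G x)"
      using 0 by simp
    also have "\<dots> = integral {0..1} (\<lambda>x. h x * cnj (h x) - h x * G x)"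
      by (intro integral_diff[symmetric] integrable_continuous_interval continuous_intros conth contG)
    finally have "complex_of_real I = integral {0..1} (\<lambda>x. h x * cnj (h x) - h x * G x)" .
    moreover have "norm (integral {0..1} (\<lambda>x. h x * cnj (h x) - h x * G x)) \<le> (M * e) * (1 - 0)"
    proof (rule integral_bound)
      show "continuous_on {0..1} (\<lambda>x. h x * cnj (h x) - h x * G x)"
        by (intro continuous_intros conth contG)
      fix x :: real assume x: "x \<in> {0..1}"
      have "norm (h x * cnj (h x) - h x * G x) = norm (h x) * norm (cnj (h x) - G x)"
        by (simp flip: norm_mult right_diff_distrib)
      also have "\<dots> \<le> M * e"
        using M(2)[OF x] g(2)[of "cis (2 * pi * x)"] M(1) F(2)[of x] unfolding G_def
        by (intro mult_mono) auto
      finally show "norm (h x * cnj (h x) - h x * G x) \<le> M * e" .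
    qed simp
    ultimately have "norm (complex_of_real I) \<le> M * e" by simp
    thus ?thesis by simp
  qed
  have "I \<le> 0"
  proof (rule field_le_epsilon)
    fix e :: real assume "e > 0"
    thus "I \<le> 0 + e" using small[of "e / M"] M(1) by simp
  qed
  moreover have "I \<ge> 0" unfolding I_def by (intro integral_nonneg integrable_continuous_interval continuous_intros conth) auto
  ultimately have "I = 0" by simp
  moreover have "(\<lambda>x. (norm (h x))\<^sup>2) integrable_on {0..1}"
    by (intro integrable_continuous_interval continuous_intros conth)
  ultimately have hi: "((\<lambda>x. (norm (h x))\<^sup>2) has_integral 0) (cbox 0 1)"
    unfolding I_def by (simp add: has_integral_iff)
  have "(norm (h 0))\<^sup>2 = 0"
    by (rule has_integral_0_cbox_imp_0[OF _ _ hi]) (auto intro!: continuous_intros conth)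
  thus ?thesis by simp
qed

section \<open>Inversion of theta series\<close>

text \<open>This is the characteristic function of the standard normal distribution, freed of the
  normalisation 1 / sqrt (2 pi).\<close>

lemma has_bochner_integral_std_gaussian:
  fixes t :: real
  shows "has_bochner_integral lborel (\<lambda>y::real. exp (- (of_real y)\<^sup>2 / 2 + \<i> * of_real (t * y)))
    (complex_of_real (sqrt (2 * pi) * exp (- (t\<^sup>2) / 2)))"
proof -
  interpret real_distribution std_normal_distribution by (rule real_dist_normal_dist)
  have dens: "std_normal_density y *\<^sub>R iexp (t * y) =
      complex_of_real (1 / sqrt (2 * pi)) * exp (- (of_real y)\<^sup>2 / 2 + \<i> * of_real (t * y))" for y
    by (simp add: std_normal_density_def scaleR_conv_of_real exp_of_real[symmetric] flip: exp_add)
  have "integrable std_normal_distribution (\<lambda>y. iexp (t * y))"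
    by (intro integrable_iexp) auto
  hence "integrable lborel (\<lambda>y. std_normal_density y *\<^sub>R iexp (t * y))"
    by (subst (asm) integrable_density) auto
  moreover have "(LINT y|lborel. std_normal_density y *\<^sub>R iexp (t * y)) = exp (- (t\<^sup>2) / 2)"
    using fun_cong[OF char_std_normal_distribution, of t] unfolding char_def
    by (subst (asm) integral_density) auto
  ultimately have "has_bochner_integral lborel (\<lambda>y. std_normal_density y *\<^sub>R iexp (t * y))
      (complex_of_real (exp (- (t\<^sup>2) / 2)))"
    by (simp add: has_bochner_integral_iff)
  hence "has_bochner_integral lborel (\<lambda>y. complex_of_real (sqrt (2 * pi)) * (std_normal_density y *\<^sub>R iexp (t * y)))
      (complex_of_real (sqrt (2 * pi)) * complex_of_real (exp (- (t\<^sup>2) / 2)))"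
    by (rule has_bochner_integral_mult_right)
  also have "(\<lambda>y. complex_of_real (sqrt (2 * pi)) * (std_normal_density y *\<^sub>R iexp (t * y))) =
      (\<lambda>y. exp (- (of_real y)\<^sup>2 / 2 + \<i> * of_real (t * y)))"
    unfolding dens by (simp add: mult.assoc[symmetric] flip: of_real_mult)
  finally show ?thesis by simp
qed

text \<open>The real affine substitution y = c x - b / c with c = sqrt (2a) completes the square for
  the real part b of B. The imaginary part only enters as the frequency of the characteristic
  function.\<close>

lemma has_bochner_integral_gaussian:
  fixes a :: real and B :: complex
  assumes "a > 0"
  shows "has_bochner_integral lborel (\<lambda>x::real. exp (- of_real a * (of_real x)\<^sup>2 + B * of_real x))
    (of_real (sqrt (pi / a)) * exp (B\<^sup>2 / (4 * of_real a)))"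
proof -
  define b \<beta> c where "b = Re B" and "\<beta> = Im B" and "c = sqrt (2 * a)"
  have c: "c > 0" "c\<^sup>2 = 2 * a" using assms by (auto simp: c_def)
  have B: "B = of_real b + \<i> * of_real \<beta>" by (simp add: b_def \<beta>_def complex_eq_iff)
  \<comment> \<open>C compensates the constants left by the substitution: b^2 / (4a) from the square
    and beta b / (2a) from the shifted phase.\<close>
  define C where "C = exp (of_real (b\<^sup>2 / (4 * a)) + \<i> * of_real (\<beta> * b / (2 * a)))"
  have "has_bochner_integral lborel (\<lambda>x. exp (- (of_real (- b / c + c * x))\<^sup>2 / 2 + \<i> * of_real (\<beta> / c * (- b / c + c * x))))
    (complex_of_real (sqrt (2 * pi) * exp (- ((\<beta> / c)\<^sup>2) / 2)) /\<^sub>R \<bar>c\<bar>)"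
    using has_bochner_integral_std_gaussian[of "\<beta> / c"] c(1)
    by (subst (asm) lborel_has_bochner_integral_real_affine_iff[of c _ _ "- b / c"]) auto
  hence "has_bochner_integral lborel (\<lambda>x. C * exp (- (of_real (- b / c + c * x))\<^sup>2 / 2 + \<i> * of_real (\<beta> / c * (- b / c + c * x))))
    (C * (complex_of_real (sqrt (2 * pi) * exp (- ((\<beta> / c)\<^sup>2) / 2)) /\<^sub>R \<bar>c\<bar>))"
    by (rule has_bochner_integral_mult_right)
  also have "(\<lambda>x. C * exp (- (of_real (- b / c + c * x))\<^sup>2 / 2 + \<i> * of_real (\<beta> / c * (- b / c + c * x)))) =
    (\<lambda>x. exp (- of_real a * (of_real x)\<^sup>2 + B * of_real x))"
  proof
    fix x :: real
    have "(- b / c + c * x)\<^sup>2 / 2 = b\<^sup>2 / (4 * a) - b * x + a * x\<^sup>2"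
    proof -
      have "(- b / c + c * x)\<^sup>2 = b\<^sup>2 / c\<^sup>2 - 2 * b * x + c\<^sup>2 * x\<^sup>2"
        using c(1) by (simp add: power2_eq_square field_simps)
      thus ?thesis using c assms by (simp add: field_simps)
    qed
    moreover have "\<beta> / c * (- b / c + c * x) = \<beta> * x - \<beta> * b / (2 * a)"
    proof -
      have "\<beta> / c * (- b / c + c * x) = \<beta> * x - \<beta> * b / c\<^sup>2"
        using c(1) by (simp add: power2_eq_square field_simps)
      thus ?thesis using c by simp
    qed
    moreover have "- (complex_of_real u)\<^sup>2 / 2 = of_real (- (u\<^sup>2 / 2))" for u
      by simp
    ultimately have 1: "- (complex_of_real (- b / c + c * x))\<^sup>2 / 2 = of_real (- (b\<^sup>2 / (4 * a) - b * x + a * x\<^sup>2))"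
      and 2: "complex_of_real (\<beta> / c * (- b / c + c * x)) = of_real (\<beta> * x - \<beta> * b / (2 * a))"
      by (simp_all only:)
    show "C * exp (- (of_real (- b / c + c * x))\<^sup>2 / 2 + \<i> * of_real (\<beta> / c * (- b / c + c * x))) =
      exp (- of_real a * (of_real x)\<^sup>2 + B * of_real x)"
      unfolding 1 2 C_def B exp_add[symmetric] by (rule arg_cong[of _ _ exp]) (simp add: algebra_simps)
  qed
  also have "C * (complex_of_real (sqrt (2 * pi) * exp (- ((\<beta> / c)\<^sup>2) / 2)) /\<^sub>R \<bar>c\<bar>) =
    of_real (sqrt (pi / a)) * exp (B\<^sup>2 / (4 * of_real a))"
  proof -
    have "sqrt (2 * pi) / c = sqrt (pi / a)"
      using assms by (simp add: c_def real_sqrt_divide real_sqrt_mult)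
    moreover have "- ((\<beta> / c)\<^sup>2) / 2 = - (\<beta>\<^sup>2 / (4 * a))"
      using c by (simp add: power_divide)
    moreover have "C * exp (of_real (- (\<beta>\<^sup>2 / (4 * a)))) = exp (B\<^sup>2 / (4 * of_real a))"
      unfolding C_def exp_add[symmetric] B using assms
      by (intro arg_cong[of _ _ exp]) (simp add: field_simps power2_eq_square)
    moreover have "C * (complex_of_real (sqrt (2 * pi) * exp (- ((\<beta> / c)\<^sup>2) / 2)) /\<^sub>R \<bar>c\<bar>) =
      of_real (sqrt (2 * pi) / c) * (C * exp (of_real (- ((\<beta> / c)\<^sup>2) / 2)))"
      using c(1) by (simp add: scaleR_conv_of_real exp_of_real[symmetric] field_simps)
    ultimately show ?thesis by simp
  qed
  finally show ?thesis .
qed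

section \<open>Interchange of sums and integrals, and the real line cut into unit intervals\<close>

lemma tendsto_integral_symmetric_interval:
  fixes f :: "real \<Rightarrow> complex"
  assumes "has_bochner_integral lborel f I"
  shows "(\<lambda>N. integral {- real N..real N} f) \<longlonglongrightarrow> I"
proof -
  have f: "integrable lborel f" and I: "I = integral\<^sup>L lborel f"
    using assms by (auto simp: has_bochner_integral_iff)
  have [measurable]: "f \<in> borel_measurable lborel" using f by simp
  have "(\<lambda>N. integral\<^sup>L lborel (\<lambda>x. indicator {- real N..real N} x *\<^sub>R f x)) \<longlonglongrightarrow> I"
    unfolding I
  proof (rule integral_dominated_convergence[where w = "\<lambda>x. norm (f x)"])
    show "AE x in lborel. (\<lambda>N. indicator {- real N..real N} x *\<^sub>R f x) \<longlonglongrightarrow> f x"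
    proof (rule AE_I2)
      fix x :: real
      have "\<forall>\<^sub>F N in sequentially. indicator {- real N..real N} x *\<^sub>R f x = f x"
        using eventually_ge_at_top[of "nat \<lceil>\<bar>x\<bar>\<rceil>"]
      proof eventually_elim
        case (elim N)
        hence "\<bar>x\<bar> \<le> real N" by linarith
        thus ?case by (auto simp: indicator_def)
      qed
      thus "(\<lambda>N. indicator {- real N..real N} x *\<^sub>R f x) \<longlonglongrightarrow> f x"
        by (rule tendsto_eventually)
    qed
  qed (use f in \<open>auto simp: indicator_def\<close>)
  moreover have "integral\<^sup>L lborel (\<lambda>x. indicator {- real N..real N} x *\<^sub>R f x) = integral {- real N..real N} f" for N
  proof -
    have "set_integrable lborel {- real N..real N} f"
      unfolding set_integrable_def using f by (intro integrable_mult_indicator) auto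
    from set_borel_integral_eq_integral(2)[OF this] show ?thesis
      unfolding set_lebesgue_integral_def .
  qed
  ultimately show ?thesis by simp
qed

lemma has_sum_integral_unit_interval:
  fixes f :: "'a \<Rightarrow> real \<Rightarrow> complex"
  assumes "\<And>n. continuous_on {0..1} (f n)" and "\<And>n x. x \<in> {0..1} \<Longrightarrow> norm (f n x) \<le> M n"
    and "M summable_on UNIV"
  shows "((\<lambda>n. integral {0..1} (f n)) has_sum integral {0..1} (\<lambda>x. \<Sum>\<^sub>\<infinity>n. f n x)) UNIV"
proof -
  have "uniform_limit {0..1} (\<lambda>X x. \<Sum>n\<in>X. f n x) (\<lambda>x. \<Sum>\<^sub>\<infinity>n. f n x) (finite_subsets_at_top UNIV)"
    using assms by (intro Weierstrass_m_test_general) auto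
  moreover have "continuous_on {0..1} (\<lambda>x. \<Sum>n\<in>X. f n x)" for X
    by (intro continuous_intros assms)
  ultimately obtain I J where IJ: "\<And>X. ((\<lambda>x. \<Sum>n\<in>X. f n x) has_integral I X) {0..1}"
      "((\<lambda>x. \<Sum>\<^sub>\<infinity>n. f n x) has_integral J) {0..1}" "(I \<longlongrightarrow> J) (finite_subsets_at_top UNIV)"
    by (rule uniform_limit_integral) auto
  have "I X = (\<Sum>n\<in>X. integral {0..1} (f n))" if "finite X" for X
  proof -
    have "I X = integral {0..1} (\<lambda>x. \<Sum>n\<in>X. f n x)"
      by (rule integral_unique[OF IJ(1), symmetric])
    also have "\<dots> = (\<Sum>n\<in>X. integral {0..1} (f n))"
      using that assms(1) by (intro integral_sum integrable_continuous_interval) auto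
    finally show ?thesis .
  qed
  hence "\<forall>\<^sub>F X in finite_subsets_at_top UNIV. I X = (\<Sum>n\<in>X. integral {0..1} (f n))"
    by (intro eventually_finite_subsets_at_top_weakI)
  with IJ(3) have "((\<lambda>X. \<Sum>n\<in>X. integral {0..1} (f n)) \<longlongrightarrow> J) (finite_subsets_at_top UNIV)"
    by (rule Lim_transform_eventually)
  thus ?thesis using IJ(2) by (simp add: has_sum_def integral_unique)
qed

text \<open>The ranges are half-open so that the unit intervals [n, n + 1] with n in the range tile
  [-N, N] exactly.\<close>

lemma has_sum_imp_tendsto_symmetric:
  fixes f :: "int \<Rightarrow> 'a :: {comm_monoid_add, topological_space}"
  assumes "(f has_sum S) UNIV"
  shows "(\<lambda>N. \<Sum>n\<in>{- int N..<int N}. f n) \<longlonglongrightarrow> S"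
proof -
  have "filterlim (\<lambda>N. {- int N..<int N}) (finite_subsets_at_top UNIV) sequentially"
    unfolding filterlim_finite_subsets_at_top
  proof (intro allI impI)
    fix X :: "int set" assume X: "finite X \<and> X \<subseteq> UNIV"
    have m: "\<bar>x\<bar> \<le> Max (abs ` X)" if "x \<in> X" for x
      using that X by (intro Max_ge) auto
    show "\<forall>\<^sub>F N in sequentially. finite {- int N..<int N} \<and> X \<subseteq> {- int N..<int N} \<and> {- int N..<int N} \<subseteq> UNIV"
      using eventually_gt_at_top[of "nat (Max (abs ` X))"]
      by eventually_elim (force dest: m)
  qed
  with assms show ?thesis unfolding has_sum_def by (rule filterlim_compose)
qed

lemma sum_integral_shift:
  fixes f :: "real \<Rightarrow> complex"
  assumes "continuous_on UNIV f"
  shows "(\<Sum>n\<in>{m..<m + int j}. integral {0..1} (\<lambda>x. f (x + of_int n))) = integral {of_int m..of_int m + real j} f"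
proof (induction j)
  case (Suc j)
  have "{m..<m + int (Suc j)} = insert (m + int j) {m..<m + int j}" by auto
  hence "(\<Sum>n\<in>{m..<m + int (Suc j)}. integral {0..1} (\<lambda>x. f (x + of_int n))) =
     integral {0..1} (\<lambda>x. f (x + (of_int m + real j))) + integral {of_int m..of_int m + real j} f"
    using Suc.IH by simp
  also have "integral {0..1} (\<lambda>x. f (x + (of_int m + real j))) = integral {of_int m + real j..of_int m + real (Suc j)} f"
    using integral_shift_real_ivl[of "of_int m + real j" "of_int m + real j" "of_int m + real (Suc j)" f] by simp
  also have "\<dots> + integral {of_int m..of_int m + real j} f = integral {of_int m..of_int m + real (Suc j)} f"
    using Henstock_Kurzweil_Integration.integral_combine[where a = "of_int m" and c = "of_int m + real j" and b = "of_int m + real (Suc j)" and f = f]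
      integrable_continuous_interval[OF continuous_on_subset[OF assms]]
    by (simp add: add.commute)
  finally show ?case .
qed simp

section \<open>Fourier coefficients and Poisson summation\<close>

lemma integral_cis_period:
  fixes k :: int
  shows "integral {0..1} (\<lambda>x::real. cis (2 * pi * k * x)) = (if k = 0 then 1 else 0)"
proof (cases "k = 0")
  case False
  have "((\<lambda>x::real. cis (2 * pi * k * x)) has_integral
      cis (2 * pi * k * 1) / (2 * pi * \<i> * k) - cis (2 * pi * k * 0) / (2 * pi * \<i> * k)) {0..1}"
  proof (rule fundamental_theorem_of_calculus)
    fix x :: real
    show "((\<lambda>x. cis (2 * pi * k * x) / (2 * pi * \<i> * k)) has_vector_derivative cis (2 * pi * k * x)) (at x within {0..1})"
      unfolding cis_conv_exp using False
      by (auto intro!: derivative_eq_intros has_vector_derivative_real_field simp: field_simps)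
  qed simp
  moreover have "cis (2 * pi * k * 1) = 1"
    using cis_multiple_2pi[of k] by (simp add: mult_ac)
  ultimately show ?thesis using False by (simp add: integral_unique)
qed simp

lemma continuous_on_theta_series_affine:
  fixes c d :: complex and A :: complex
  assumes "Re A < 0"
  shows "continuous_on UNIV (\<lambda>x::real. theta_series A (c + d * of_real x))"
proof -
  have "(\<lambda>s. theta_series A (c + d * s)) holomorphic_on UNIV"
    using assms by (intro holomorphic_on_theta_series holomorphic_intros) auto
  hence "continuous_on UNIV (\<lambda>s. theta_series A (c + d * s))"
    by (rule holomorphic_on_imp_continuous_on)
  thus ?thesis
    by (rule continuous_on_compose2[of UNIV _ UNIV of_real]) (auto intro: continuous_intros)
qed

text \<open>The unfolding argument: cis (2 pi k x) has period 1, so it can be absorbed into each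
  translate. The sum of unit-interval integrals then becomes one Gaussian integral over the line,
  with B shifted by 2 pi i k.\<close>

lemma periodized_gaussian_fourier_coeff:
  fixes a :: real and B :: complex and k :: int
  assumes "a > 0"
  shows "integral {0..1} (\<lambda>x. (\<Sum>\<^sub>\<infinity>n::int. exp (- of_real a * (of_real (x + of_int n))\<^sup>2 + B * of_real (x + of_int n)))
            * cis (2 * pi * k * x)) =
         of_real (sqrt (pi / a)) * exp ((B + 2 * pi * \<i> * k)\<^sup>2 / (4 * of_real a))"
proof -
  define G :: "real \<Rightarrow> complex" where
    "G = (\<lambda>x. exp (- of_real a * (of_real x)\<^sup>2 + (B + 2 * pi * \<i> * k) * of_real x))"
  \<comment> \<open>For x in [0, 1], expanding the square bounds the factors free of n by exp (norm
    B), and the cross term -2 a x n adds at most 2 a |n| to the exponent.\<close>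
  define M where "M = (\<lambda>n::int. exp (norm B) * exp (- a * of_int n ^ 2 + (norm B + 2 * a) * \<bar>of_int n\<bar>))"
  have contG: "continuous_on S G" for S unfolding G_def by (intro continuous_intros)
  have G: "exp (- of_real a * (of_real (x + of_int n))\<^sup>2 + B * of_real (x + of_int n)) * cis (2 * pi * k * x) = G (x + of_int n)"
    for x and n :: int
  proof -
    have "cis (2 * pi * k * x) = cis (2 * pi * k * x) * cis (2 * pi * of_int (k * n))"
      using cis_multiple_2pi[of "of_int (k * n)"] by (simp add: mult_ac)
    also have "\<dots> = exp (2 * pi * \<i> * k * of_real (x + of_int n))"
      by (simp add: cis_conv_exp algebra_simps flip: exp_add)
    finally show ?thesis unfolding G_def by (simp add: algebra_simps flip: exp_add)
  qed
  have bound: "norm (G (x + of_int n)) \<le> M n" if x: "x \<in> {0..1}" for x and n :: int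
  proof -
    have "exp (- of_real a * (of_real (x + of_int n))\<^sup>2 + B * of_real (x + of_int n)) =
      exp (- of_real a * (of_real x)\<^sup>2) * exp (B * of_real x) * exp (- of_real a * of_int n ^ 2 + (B - 2 * of_real (a * x)) * of_int n)"
      by (simp add: algebra_simps power2_eq_square flip: exp_add)
    hence "norm (G (x + of_int n)) = norm (exp (- complex_of_real a * (of_real x)\<^sup>2)) * norm (exp (B * of_real x)) *
      norm (exp (- of_real a * of_int n ^ 2 + (B - 2 * of_real (a * x)) * of_int n))"
      unfolding G[symmetric] by (simp only: norm_mult norm_cis mult_1_right)
    also have "\<dots> \<le> 1 * exp (norm B) * exp (- a * of_int n ^ 2 + (norm B + 2 * a) * \<bar>of_int n\<bar>)"
    proof (intro mult_mono mult_nonneg_nonneg)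
      have "0 \<le> a * x\<^sup>2" using assms by simp
      thus "norm (exp (- complex_of_real a * (of_real x)\<^sup>2)) \<le> 1"
        by (simp flip: of_real_power)
      have "norm (B * of_real x) \<le> norm B * 1"
        unfolding norm_mult using x by (intro mult_left_mono) auto
      thus "norm (exp (B * of_real x)) \<le> exp (norm B)"
        by (intro order_trans[OF norm_exp]) simp
      have "norm (B - 2 * of_real (a * x)) \<le> norm B + norm (2 * complex_of_real (a * x))"
        by (rule norm_triangle_ineq4)
      also have "norm (2 * complex_of_real (a * x)) \<le> 2 * a"
        using x assms by (simp add: norm_mult mult_left_le)
      finally show "norm (exp (- of_real a * of_int n ^ 2 + (B - 2 * of_real (a * x)) * of_int n)) \<le>
          exp (- a * of_int n ^ 2 + (norm B + 2 * a) * \<bar>of_int n\<bar>)"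
        by (intro norm_theta_term_le) auto
    qed auto
    finally show ?thesis unfolding M_def by simp
  qed
  have "((\<lambda>n. integral {0..1} (\<lambda>x. G (x + of_int n))) has_sum
      integral {0..1} (\<lambda>x. \<Sum>\<^sub>\<infinity>n::int. G (x + of_int n))) UNIV"
  proof (rule has_sum_integral_unit_interval[OF _ bound])
    show "M summable_on UNIV"
      unfolding M_def by (intro summable_on_cmult_right summable_on_gaussian assms)
    show "continuous_on {0..1} (\<lambda>x. G (x + of_int n))" for n
      by (rule continuous_on_compose2[OF contG[of UNIV]]) (auto intro: continuous_intros)
  qed
  hence "(\<lambda>N. \<Sum>n\<in>{- int N..<int N}. integral {0..1} (\<lambda>x. G (x + of_int n))) \<longlonglongrightarrow>
      integral {0..1} (\<lambda>x. \<Sum>\<^sub>\<infinity>n::int. G (x + of_int n))"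
    by (rule has_sum_imp_tendsto_symmetric)
  moreover have "(\<Sum>n\<in>{- int N..<int N}. integral {0..1} (\<lambda>x. G (x + of_int n))) = integral {- real N..real N} G" for N
    using sum_integral_shift[OF contG, of "- int N" "2 * N"] by simp
  moreover have "(\<lambda>N. integral {- real N..real N} G) \<longlonglongrightarrow>
      of_real (sqrt (pi / a)) * exp ((B + 2 * pi * \<i> * k)\<^sup>2 / (4 * of_real a))"
    unfolding G_def by (intro tendsto_integral_symmetric_interval has_bochner_integral_gaussian assms)
  ultimately have "integral {0..1} (\<lambda>x. \<Sum>\<^sub>\<infinity>n::int. G (x + of_int n)) =
      of_real (sqrt (pi / a)) * exp ((B + 2 * pi * \<i> * k)\<^sup>2 / (4 * of_real a))"
    using LIMSEQ_unique by auto
  thus ?thesis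
    unfolding G[symmetric] infsum_cmult_left' .
qed

text \<open>The shift of B by 2 pi i x turns the theta series into a Fourier series in x. Against
  cis (2 pi k x) only the term n = -k survives, whence the sign of B on the right.\<close>

lemma theta_series_fourier_coeff:
  fixes A B :: complex and k :: int
  assumes "Re A < 0"
  shows "integral {0..1} (\<lambda>x. theta_series A (B + 2 * pi * \<i> * of_real x) * cis (2 * pi * k * x)) =
    exp (A * of_int k ^ 2 - B * of_int k)"
proof -
  define f where "f = (\<lambda>(n::int) (x::real). exp (A * of_int n ^ 2 + B * of_int n) * cis (2 * pi * of_int (n + k) * x))"
  have eq: "(\<Sum>\<^sub>\<infinity>n. f n x) = theta_series A (B + 2 * pi * \<i> * of_real x) * cis (2 * pi * k * x)" for x
  proof -
    have "f n x = exp (A * of_int n ^ 2 + (B + 2 * pi * \<i> * of_real x) * of_int n) * cis (2 * pi * k * x)" for n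
      unfolding f_def by (simp add: cis_conv_exp algebra_simps flip: exp_add)
    thus ?thesis by (simp add: theta_series_def infsum_cmult_left')
  qed
  have "((\<lambda>n. integral {0..1} (f n)) has_sum integral {0..1} (\<lambda>x. \<Sum>\<^sub>\<infinity>n. f n x)) UNIV"
  proof (rule has_sum_integral_unit_interval)
    show "continuous_on {0..1} (f n)" for n
      unfolding f_def by (intro continuous_intros)
    show "norm (f n x) \<le> norm (exp (A * of_int n ^ 2 + B * of_int n))" for n x
      unfolding f_def by (simp only: norm_mult norm_cis mult_1_right)
  qed (rule abs_summable_theta[OF assms])
  moreover have "integral {0..1} (f n) = (if n = - k then exp (A * of_int k ^ 2 - B * of_int k) else 0)" for n
    unfolding f_def using integral_cis_period[of "n + k"] by (auto simp del: of_int_add)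
  hence "((\<lambda>n. integral {0..1} (f n)) has_sum exp (A * of_int k ^ 2 - B * of_int k)) UNIV"
    by (intro has_sum_finite_neutralI[of "{- k}"]) auto
  ultimately show ?thesis
    unfolding eq using has_sum_unique by blast
qed

text \<open>S is the periodised Gaussian and H the Fourier series that Poisson summation predicts
  for it. Both are continuous, have period 1 and share all Fourier coefficients; the claim is their
  equality at x = 0.\<close>

lemma theta_inversion_real:
  fixes a :: real and B :: complex
  assumes "a > 0"
  shows "theta_series (- of_real a) B = of_real (sqrt (pi / a)) * exp (B\<^sup>2 / (4 * of_real a)) *
     theta_series (- (of_real (pi\<^sup>2 / a))) (- \<i> * pi * B / of_real a)"
proof -
  define S where "S = (\<lambda>x::real. \<Sum>\<^sub>\<infinity>n::int. exp (- of_real a * (of_real (x + of_int n))\<^sup>2 + B * of_real (x + of_int n)))"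
  define C where "C = of_real (sqrt (pi / a)) * exp (B\<^sup>2 / (4 * of_real a))"
  define H where "H = (\<lambda>x::real. C * theta_series (- of_real (pi\<^sup>2 / a)) (- \<i> * pi * B / of_real a + 2 * pi * \<i> * of_real x))"
  have pos: "Re (- complex_of_real (pi\<^sup>2 / a)) < 0" "Re (- complex_of_real a) < 0" using assms by auto
  have contH: "continuous_on UNIV H"
    unfolding H_def by (intro continuous_intros continuous_on_theta_series_affine pos)
  \<comment> \<open>Expanding the square exhibits S as an elementary factor times a theta series
    with affine argument, which gives its continuity.\<close>
  have S: "S x = exp (- of_real a * (of_real x)\<^sup>2 + B * of_real x) * theta_series (- of_real a) (B + (- 2 * of_real a) * of_real x)" for x
    unfolding S_def theta_series_def infsum_cmult_right'[symmetric] exp_add[symmetric]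
    by (intro infsum_cong arg_cong[of _ _ exp]) (simp add: algebra_simps power2_eq_square)
  have contS: "continuous_on UNIV S"
    unfolding S[abs_def] by (intro continuous_intros continuous_on_theta_series_affine pos)
  have perS: "S (x + 1) = S x" for x
    unfolding S_def
    by (rule infsum_reindex_bij_witness[of _ "\<lambda>n. n - 1" "\<lambda>n. n + 1"]) (auto simp: add_ac)
  have perH: "H (x + 1) = H x" for x
  proof -
    have "exp (u + (v + 2 * pi * \<i> * of_real (x + 1)) * of_int n) = exp (u + (v + 2 * pi * \<i> * of_real x) * of_int n)"
      for u v and n :: int
    proof -
      have "exp (u + (v + 2 * pi * \<i> * of_real (x + 1)) * of_int n) =
          exp (u + (v + 2 * pi * \<i> * of_real x) * of_int n) * exp (2 * of_real pi * \<i> * of_int n)"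
        unfolding exp_add[symmetric] by (rule arg_cong[of _ _ exp]) (simp add: algebra_simps)
      also have "exp (2 * of_real pi * \<i> * of_int n) = (1 :: complex)"
        using exp_integer_2pi[of "of_int n"] by (simp add: mult_ac)
      finally show ?thesis by simp
    qed
    thus ?thesis unfolding H_def theta_series_def by (simp only:)
  qed
  have "S 0 - H 0 = 0"
  proof (rule fourier_uniqueness[of "\<lambda>x. S x - H x"])
    show "continuous_on UNIV (\<lambda>x. S x - H x)" by (intro continuous_intros contS contH)
    show "S (x + 1) - H (x + 1) = S x - H x" for x by (simp add: perS perH)
    fix k :: int
    have "integral {0..1} (\<lambda>x. S x * cis (2 * pi * k * x)) =
        of_real (sqrt (pi / a)) * exp ((B + 2 * pi * \<i> * k)\<^sup>2 / (4 * of_real a))"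
      unfolding S_def by (rule periodized_gaussian_fourier_coeff[OF assms])
    \<comment> \<open>Expand the square: (B + 2 pi i k)^2 / (4a) = B^2 / (4a) + pi i B k / a - pi^2
      k^2 / a.\<close>
    also have "exp ((B + 2 * pi * \<i> * k)\<^sup>2 / (4 * of_real a)) = exp (B\<^sup>2 / (4 * of_real a)) *
        exp (- of_real (pi\<^sup>2 / a) * of_int k ^ 2 - (- \<i> * pi * B / of_real a) * of_int k)"
      unfolding exp_add[symmetric] using assms
      by (intro arg_cong[of _ _ exp]) (simp add: field_simps power2_eq_square)
    finally have 1: "integral {0..1} (\<lambda>x. S x * cis (2 * pi * k * x)) =
        C * exp (- of_real (pi\<^sup>2 / a) * of_int k ^ 2 - (- \<i> * pi * B / of_real a) * of_int k)"
      by (simp add: C_def)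
    have 2: "integral {0..1} (\<lambda>x. H x * cis (2 * pi * k * x)) =
        C * exp (- of_real (pi\<^sup>2 / a) * of_int k ^ 2 - (- \<i> * pi * B / of_real a) * of_int k)"
      unfolding H_def mult.assoc[of C] integral_mult_right
      by (subst theta_series_fourier_coeff[OF pos(1)]) simp
    have int: "(\<lambda>x. F x * cis (2 * pi * k * x)) integrable_on {0..1}" if "continuous_on UNIV F" for F
      using continuous_on_subset[OF that] by (intro integrable_continuous_interval continuous_intros) auto
    show "integral {0..1} (\<lambda>x. (S x - H x) * cis (2 * pi * k * x)) = 0"
      unfolding left_diff_distrib
      by (subst Henstock_Kurzweil_Integration.integral_diff) (simp_all only: int contS contH 1 2 diff_self)
  qed
  thus ?thesis unfolding S H_def C_def by simp
qed

text \<open>Both sides are holomorphic in A on the left half-plane and agree on the negative reals,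
  which accumulate at -1. For Re A < 0 the number pi / (-A) lies in the right half-plane, away from
  the cut of \<open>csqrt\<close>.\<close>

theorem theta_inversion:
  fixes A B :: complex
  assumes "Re A < 0"
  shows "theta_series A B = csqrt (pi / (- A)) * exp (- B\<^sup>2 / (4 * A)) * theta_series (pi\<^sup>2 / A) (\<i> * pi * B / A)"
proof -
  define S where "S = {s. Re s < 0}"
  define f where "f = (\<lambda>A :: complex. theta_series A B - csqrt (pi / (- A)) * exp (- B\<^sup>2 / (4 * A)) * theta_series (pi\<^sup>2 / A) (\<i> * pi * B / A))"
  have nz: "s \<noteq> 0" if "s \<in> S" for s using that by (auto simp: S_def)
  have neg: "Re (of_real c / s) < 0" if "s \<in> S" "c > 0" for s and c :: real
    using that unfolding S_def by (simp add: Re_complex_div_lt_0 mult_pos_neg)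
  have hol: "f holomorphic_on S"
    unfolding f_def
  proof (intro holomorphic_intros holomorphic_on_theta_series)
    show "open S" unfolding S_def by (rule open_halfspace_Re_lt)
    show "of_real pi / (- z) \<notin> \<real>\<^sub>\<le>\<^sub>0" if "z \<in> S" for z
      using neg[OF that pi_gt_zero] unfolding complex_nonpos_Reals_iff by simp
    show "Re (complex_of_real (pi\<^sup>2) / s) < 0" if "s \<in> S" for s
      using neg[OF that, of "pi\<^sup>2"] by simp
  qed (use nz in \<open>auto simp: S_def open_halfspace_Re_lt\<close>)
  have "f A = 0"
  proof (rule analytic_continuation[OF hol])
    show "open S" unfolding S_def by (rule open_halfspace_Re_lt)
    show "connected S" unfolding S_def by (intro convex_connected convex_halfspace_Re_lt)
    show "of_real ` {..<0} \<subseteq> S" by (auto simp: S_def)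
    show "- 1 \<in> S" by (simp add: S_def)
    show "(- 1 :: complex) islimpt of_real ` {..<0}"
    proof -
      have "(-1 :: real) islimpt {..<0}" by (intro interior_limit_point) (simp add: interior_open)
      hence "complex_of_real (-1) islimpt of_real ` {..<0}"
      proof (rule islimpt_isCont_image)
        show "\<forall>\<^sub>F x in at (- 1). complex_of_real x \<noteq> complex_of_real (- 1)"
          by (simp only: of_real_eq_iff) (simp add: eventually_at_filter)
      qed simp
      thus ?thesis by simp
    qed
    show "A \<in> S" using assms by (simp add: S_def)
    fix z :: complex assume "z \<in> of_real ` {..<0}"
    then obtain r where "z = of_real r" "r < 0" by blast
    then obtain a where a: "z = - of_real a" "a > 0" by (intro that[of "- r"]) auto
    have "csqrt (pi / (- z)) = of_real (sqrt (pi / a))"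
      using a of_real_sqrt[of "pi / a"] by simp
    thus "f z = 0" unfolding f_def using theta_inversion_real[OF a(2), of B] a by simp
  qed
  thus ?thesis by (simp add: f_def)
qed

section \<open>Inversion of the eta function\<close>

lemma infsum_int_mod_3:
  fixes f :: "int \<Rightarrow> complex"
  assumes "(\<lambda>n. norm (f n)) summable_on UNIV"
  shows "infsum f UNIV = infsum (\<lambda>n. f (3 * n)) UNIV + infsum (\<lambda>n. f (3 * n + 1)) UNIV + infsum (\<lambda>n. f (3 * n - 1)) UNIV"
proof -
  have sub: "f summable_on S" for S
    using summable_on_subset_banach[OF abs_summable_summable[OF assms]] by blast
  let ?R = "\<lambda>c. range (\<lambda>n::int. 3 * n + c)"
  have re: "infsum f (?R c) = infsum (\<lambda>n. f (3 * n + c)) UNIV" for c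
    by (subst infsum_reindex) (auto simp: inj_on_def o_def)
  have "n \<in> ?R 0 \<union> ?R 1 \<union> ?R (-1)" for n
  proof -
    consider "n mod 3 = 0" | "n mod 3 = 1" | "n mod 3 = 2" by linarith
    thus ?thesis
    proof cases
      case 1
      hence "n = 3 * (n div 3) + 0" by presburger
      thus ?thesis by blast
    next
      case 2
      hence "n = 3 * (n div 3) + 1" by presburger
      thus ?thesis by blast
    next
      case 3
      hence "n = 3 * (n div 3 + 1) + (- 1)" by presburger
      thus ?thesis by blast
    qed
  qed
  hence "UNIV = ?R 0 \<union> ?R 1 \<union> ?R (-1)" by blast
  hence "infsum f UNIV = infsum f (?R 0 \<union> ?R 1 \<union> ?R (-1))" by (rule arg_cong)
  also have "\<dots> = infsum f (?R 0 \<union> ?R 1) + infsum f (?R (-1))"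
    by (intro infsum_Un_disjoint sub) (auto, presburger+)
  also have "infsum f (?R 0 \<union> ?R 1) = infsum f (?R 0) + infsum f (?R 1)"
    by (intro infsum_Un_disjoint sub) (auto, presburger+)
  finally show ?thesis unfolding re by simp
qed

text \<open>The pentagonal number theorem. With q = exp A, the triple product for nome q^3 and w =
  -1 / q has the factors 1 - q^(6k+2) and 1 - q^(6k+4); multiplying by the factors 1 - q^(6k+6) of
  \<open>qfac (3 * A)\<close> restores all even exponents.\<close>

lemma euler_prod_eq_theta_series:
  assumes "Re A < 0"
  shows "euler_prod A = theta_series (3 * A) (\<i> * pi - A)"
proof -
  have neg: "Re (3 * A) < 0" using assms by simp
  define P where "P = (\<lambda>N. \<Prod>k<N. (1 + exp (3 * A * (2 * of_nat k + 1) + (\<i> * pi - A))) *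
      (1 + exp (3 * A * (2 * of_nat k + 1) - (\<i> * pi - A))))"
  have "P N * qfac (3 * A) N = qfac A (3 * N)" for N
  proof (induction N)
    case (Suc N)
    have 3: "3 * Suc N = Suc (Suc (Suc (3 * N)))" by simp
    have e1: "exp (3 * A * (2 * of_nat N + 1) + (\<i> * pi - A)) = - exp (2 * A * of_nat (Suc (3 * N)))"
    proof -
      have "3 * A * (2 * of_nat N + 1) + (\<i> * pi - A) = \<i> * pi + 2 * A * of_nat (Suc (3 * N))"
        by (simp add: algebra_simps)
      thus ?thesis by (simp only: exp_add exp_pi_i' mult_minus1)
    qed
    have e2: "exp (3 * A * (2 * of_nat N + 1) - (\<i> * pi - A)) = - exp (2 * A * of_nat (Suc (Suc (3 * N))))"
    proof -
      have "3 * A * (2 * of_nat N + 1) - (\<i> * pi - A) = 2 * A * of_nat (Suc (Suc (3 * N))) - \<i> * pi"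
        by (simp add: algebra_simps)
      thus ?thesis by (simp only: exp_diff exp_pi_i') simp
    qed
    have e3: "2 * (3 * A) * of_nat (Suc N) = 2 * A * of_nat (Suc (Suc (Suc (3 * N))))"
      by (simp add: algebra_simps)
    have "P (Suc N) * qfac (3 * A) (Suc N) = (P N * qfac (3 * A) N) *
      (1 - exp (2 * A * of_nat (Suc (3 * N)))) * (1 - exp (2 * A * of_nat (Suc (Suc (3 * N))))) *
      (1 - exp (2 * A * of_nat (Suc (Suc (Suc (3 * N))))))"
      unfolding P_def qfac_def prod.lessThan_Suc e1 e2 e3 by (simp only: mult_ac add_uminus_conv_diff)
    also have "\<dots> = qfac A (3 * Suc N)"
      unfolding Suc.IH unfolding 3 by (simp add: qfac_def del: of_nat_Suc)
    finally show ?case .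
  qed (simp add: P_def qfac_def)
  moreover have "(\<lambda>N. P N * qfac (3 * A) N) \<longlonglongrightarrow>
      theta_series (3 * A) (\<i> * pi - A) / euler_prod (3 * A) * euler_prod (3 * A)"
    unfolding P_def by (intro tendsto_mult jacobi_triple_product qfac_tendsto neg)
  moreover have "(\<lambda>N. qfac A (3 * N)) \<longlonglongrightarrow> euler_prod A"
  proof (rule filterlim_compose[OF qfac_tendsto[OF assms]])
    show "filterlim (\<lambda>N::nat. 3 * N) at_top at_top" by real_asymp
  qed
  ultimately show ?thesis
    using LIMSEQ_unique euler_prod_nonzero[OF neg] by fastforce
qed

lemma csqrt_of_real_mult:
  assumes "r \<ge> 0"
  shows "csqrt (of_real r * z) = of_real (sqrt r) * csqrt z"
proof (cases "r = 0")
  case False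
  hence r: "r > 0" using assms by simp
  show ?thesis
  proof (rule csqrt_unique)
    have "(of_real (sqrt r) * csqrt z)\<^sup>2 = of_real ((sqrt r)\<^sup>2) * (csqrt z)\<^sup>2"
      by (simp only: power_mult_distrib of_real_power)
    thus "(of_real (sqrt r) * csqrt z)\<^sup>2 = of_real r * z" using r by simp
    show "0 < Re (of_real (sqrt r) * csqrt z) \<or> Re (of_real (sqrt r) * csqrt z) = 0 \<and> 0 \<le> Im (of_real (sqrt r) * csqrt z)"
      using csqrt_principal[of z] r by auto
  qed
qed simp

text \<open>
  Split the left-hand series by residues modulo 3: the classes 0 and 1 each give the right-hand
  series up to a phase, and the class 2 is odd under the reflection \<open>n \<mapsto> 1 - n\<close>, hence vanishes.
\<close>

lemma theta_series_cubic:
  assumes "Re C < 0"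
  shows "exp (\<i> * pi / 6) * theta_series (C / 3) (- C / 3 - \<i> * pi / 3) =
    of_real (sqrt 3) * theta_series (3 * C) (\<i> * pi - C)"
proof -
  define t where "t = (\<lambda>m::int. exp (C / 3 * of_int m ^ 2 + (- C / 3 - \<i> * pi / 3) * of_int m))"
  define U where "U = theta_series (3 * C) (\<i> * pi - C)"
  have per: "exp (z + 2 * of_real pi * \<i> * of_int n) = exp z" for z and n :: int
    using exp_plus_2pin[of z n] by (simp add: mult_ac)
  have "(\<lambda>m. norm (t m)) summable_on UNIV"
    unfolding t_def using assms by (intro abs_summable_theta) simp
  hence split: "infsum t UNIV = infsum (\<lambda>n. t (3 * n)) UNIV + infsum (\<lambda>n. t (3 * n + 1)) UNIV + infsum (\<lambda>n. t (3 * n - 1)) UNIV"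
    by (rule infsum_int_mod_3)
  have t0: "infsum (\<lambda>n. t (3 * n)) UNIV = U"
    unfolding U_def theta_series_def
  proof (rule infsum_cong)
    fix n :: int
    have "3 * C * of_int n ^ 2 + (\<i> * pi - C) * of_int n =
        (C / 3 * of_int (3 * n) ^ 2 + (- C / 3 - \<i> * pi / 3) * of_int (3 * n)) + 2 * of_real pi * \<i> * of_int n"
      by (simp add: algebra_simps power2_eq_square)
    thus "t (3 * n) = exp (3 * C * of_int n ^ 2 + (\<i> * pi - C) * of_int n)"
      unfolding t_def by (simp only: per)
  qed
  have t1: "infsum (\<lambda>n. t (3 * n + 1)) UNIV = exp (- \<i> * pi / 3) * U"
    unfolding U_def theta_series_def infsum_cmult_right'[symmetric] t_def exp_add[symmetric]
    by (rule infsum_reindex_bij_witness[of _ uminus uminus]; (rule arg_cong[of _ _ exp])?)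
       (auto simp: algebra_simps power2_eq_square add_divide_distrib diff_divide_distrib)
  define V where "V = infsum (\<lambda>n. t (3 * n - 1)) UNIV"
  have "V = infsum (\<lambda>n. - t (3 * n - 1)) UNIV"
    unfolding V_def
  proof (rule infsum_reindex_bij_witness[of _ "\<lambda>n. 1 - n" "\<lambda>n. 1 - n"])
    fix n :: int
    have "(C / 3 * of_int (3 * (1 - n) - 1) ^ 2 + (- C / 3 - \<i> * pi / 3) * of_int (3 * (1 - n) - 1)) + \<i> * pi =
        (C / 3 * of_int (3 * n - 1) ^ 2 + (- C / 3 - \<i> * pi / 3) * of_int (3 * n - 1)) + 2 * of_real pi * \<i> * of_int n"
      by (simp add: field_simps power2_eq_square)
    hence "exp ((C / 3 * of_int (3 * (1 - n) - 1) ^ 2 + (- C / 3 - \<i> * pi / 3) * of_int (3 * (1 - n) - 1)) + \<i> * pi) = t (3 * n - 1)"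
      unfolding t_def by (simp only: per)
    thus "- t (3 * (1 - n) - 1) = t (3 * n - 1)"
      unfolding t_def by (simp only: exp_add exp_pi_i' mult_minus1_right)
  qed auto
  hence "V = - V" unfolding V_def by (simp add: infsum_uminus)
  hence V: "V = 0" by simp
  have "theta_series (C / 3) (- C / 3 - \<i> * pi / 3) = U + exp (- \<i> * pi / 3) * U"
    using split t0 t1 V by (simp add: theta_series_def t_def V_def)
  hence "exp (\<i> * pi / 6) * theta_series (C / 3) (- C / 3 - \<i> * pi / 3) =
      (exp (\<i> * pi / 6) + exp (\<i> * pi / 6) * exp (- \<i> * pi / 3)) * U"
    by (simp add: algebra_simps)
  \<comment> \<open>The factor exp (i pi / 6) balances the phases 1 and exp (-i pi / 3) into a
    conjugate pair with sum 2 cos (pi / 6) = sqrt 3.\<close>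
  also have "exp (\<i> * pi / 6) + exp (\<i> * pi / 6) * exp (- \<i> * pi / 3) = cis (pi / 6) + cis (- (pi / 6))"
    unfolding exp_add[symmetric] cis_conv_exp by (simp add: algebra_simps)
  also have "\<dots> = of_real (sqrt 3)"
    by (simp add: complex_eq_iff cos_30)
  finally show ?thesis by (simp add: U_def)
qed

text \<open>Inverting the pentagonal theta series at 3A lands at parameter C / 3 with C = pi^2 / A,
  whereas the pentagonal series for C sits at 3C. \<open>theta_series_cubic\<close> bridges the two,
  and its factor sqrt 3 makes up for the square root having been taken at 3A.\<close>

theorem eta_inversion:
  fixes A :: complex
  assumes "Re A < 0"
  shows "exp (A / 12) * euler_prod A = csqrt (pi / (- A)) * (exp (pi\<^sup>2 / A / 12) * euler_prod (pi\<^sup>2 / A))"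
proof -
  define C where "C = of_real (pi\<^sup>2) / A"
  have nz: "A \<noteq> 0" using assms by auto
  have "Re C = pi\<^sup>2 * Re A / (cmod A)\<^sup>2"
    unfolding C_def by (simp add: Re_divide cmod_power2)
  hence C: "Re C < 0" using assms nz by (simp add: divide_neg_pos mult_pos_neg)
  define X where "X = csqrt (pi / (- (3 * A)))"
  have sq: "csqrt (pi / (- A)) = of_real (sqrt 3) * X"
  proof -
    have "of_real pi / (- A) = of_real 3 * (of_real pi / (- (3 * A)))" using nz by simp
    thus ?thesis unfolding X_def using csqrt_of_real_mult[of 3 "pi / (- (3 * A))"] by simp
  qed
  have "euler_prod A = theta_series (3 * A) (\<i> * pi - A)"
    by (rule euler_prod_eq_theta_series[OF assms])
  also have "\<dots> = X * exp (- (\<i> * pi - A)\<^sup>2 / (4 * (3 * A))) *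
      theta_series (pi\<^sup>2 / (3 * A)) (\<i> * pi * (\<i> * pi - A) / (3 * A))"
    unfolding X_def using assms by (intro theta_inversion) simp
  also have "pi\<^sup>2 / (3 * A) = C / 3" by (simp add: C_def)
  also have "\<i> * pi * (\<i> * pi - A) / (3 * A) = - C / 3 - \<i> * pi / 3"
    using nz by (simp add: C_def field_simps power2_eq_square)
  finally have "exp (A / 12) * euler_prod A =
      X * (exp (A / 12) * exp (- (\<i> * pi - A)\<^sup>2 / (4 * (3 * A)))) * theta_series (C / 3) (- C / 3 - \<i> * pi / 3)"
    by (simp add: mult_ac)
  \<comment> \<open>Since -(i pi - A)^2 / (12 A) = C / 12 + i pi / 6 - A / 12, the factor exp (A /
    12) cancels exactly and its dual exp (C / 12) appears.\<close>
  also have "exp (A / 12) * exp (- (\<i> * pi - A)\<^sup>2 / (4 * (3 * A))) = exp (C / 12) * exp (\<i> * pi / 6)"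
    unfolding exp_add[symmetric] using nz
    by (intro arg_cong[of _ _ exp]) (simp add: C_def field_simps power2_eq_square)
  also have "X * (exp (C / 12) * exp (\<i> * pi / 6)) * theta_series (C / 3) (- C / 3 - \<i> * pi / 3) =
      X * exp (C / 12) * (exp (\<i> * pi / 6) * theta_series (C / 3) (- C / 3 - \<i> * pi / 3))"
    by (simp add: mult_ac)
  also have "\<dots> = csqrt (pi / (- A)) * (exp (C / 12) * euler_prod C)"
    unfolding theta_series_cubic[OF C] sq euler_prod_eq_theta_series[OF C] by (simp add: mult_ac)
  finally show ?thesis unfolding C_def .
qed

section \<open>F3 as a quotient of theta and eta, and its inversion\<close>

lemma theta3_eq_theta_series:
  "theta3 (of_real pi * t * z) (ee (of_real a * z)) =
     theta_series (2 * of_real pi * \<i> * of_real a * z) (2 * of_real pi * \<i> * t * z)"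
  unfolding theta3_def theta_series_def ee_def
  by (intro infsum_cong) (simp add: algebra_simps flip: exp_of_nat_mult exp_add)

lemma F3_eq_theta_series:
  fixes a :: real and t z :: complex
  assumes "a > 0" and "Im z > 0"
  defines "A \<equiv> 2 * of_real pi * \<i> * of_real a * z" and "B \<equiv> 2 * of_real pi * \<i> * t * z"
  shows "Re A < 0"
    and "F3 a t z = exp (B\<^sup>2 / (4 * A)) * theta_series A B / (exp (A / 12) * euler_prod A)"
proof -
  show "Re A < 0" unfolding A_def using assms(1,2) by simp
  have z: "z \<noteq> 0" using assms(2) by auto
  have "(\<Prod>n. 1 - ee (2 * of_real a * of_nat (Suc n) * z)) = euler_prod A"
    unfolding euler_prod_def ee_def A_def by (simp only: mult_ac)
  moreover have "ee ((of_real a / 12 - t\<^sup>2 / (4 * of_real a)) * z) = exp (A / 12) / exp (B\<^sup>2 / (4 * A))"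
    unfolding exp_diff[symmetric] ee_def A_def B_def using assms(1) z
    by (intro arg_cong[of _ _ exp]) (simp add: field_simps power2_eq_square)
  ultimately show "F3 a t z = exp (B\<^sup>2 / (4 * A)) * theta_series A B / (exp (A / 12) * euler_prod A)"
    unfolding F3_def theta3_eq_theta_series A_def[symmetric] B_def[symmetric] by simp
qed

text \<open>Theta and eta acquire the same square root, which cancels in the quotient. The factor
  exp (-B^2 / (4A)) from theta inversion cancels the prefactor of F3 at (A, B), while the prefactor
  at the inverted point is exp (-B^2 / (4A)); this is the factor in the claim.\<close>

lemma F3_inversion:
  fixes a :: real and t z :: complex
  assumes a: "a > 0" and z: "Im z > 0"
  shows "F3 (1 / a) (2 * t * z / of_real a) (- 1 / (4 * z)) =
           exp (- \<i> * of_real pi * t^2 * z / (2 * of_real a)) * F3 a t z"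
proof -
  define A where "A = 2 * of_real pi * \<i> * of_real a * z"
  define B where "B = 2 * of_real pi * \<i> * t * z"
  define A' where "A' = of_real (pi\<^sup>2) / A"
  define B' where "B' = \<i> * pi * B / A"
  have nz: "z \<noteq> 0" "A \<noteq> 0" using a z by (auto simp: A_def)
  have Im': "Im (- 1 / (4 * z)) > 0"
    using z by (simp add: Im_divide divide_less_0_iff add_pos_nonneg add_nonneg_pos zero_less_mult_iff sum_power2_gt_zero_iff)
  have A': "2 * of_real pi * \<i> * of_real (1 / a) * (- 1 / (4 * z)) = A'"
    using a nz by (simp add: A'_def A_def field_simps power2_eq_square)
  \<comment> \<open>The given t' produces -B' rather than B'; evenness of the theta series in its
    second argument absorbs the sign.\<close>
  have B': "2 * of_real pi * \<i> * (2 * t * z / of_real a) * (- 1 / (4 * z)) = - B'"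
    using a nz by (simp add: B'_def B_def A_def field_simps)
  have E: "B'\<^sup>2 / (4 * A') = - (B\<^sup>2 / (4 * A))"
    using nz by (simp add: B'_def A'_def field_simps power2_eq_square)
  have F': "F3 (1 / a) (2 * t * z / of_real a) (- 1 / (4 * z)) =
      exp (- (B\<^sup>2 / (4 * A))) * theta_series A' B' / (exp (A' / 12) * euler_prod A')"
    using F3_eq_theta_series(2)[of "1 / a" "- 1 / (4 * z)" "2 * t * z / of_real a"] a Im'
    unfolding A' B' theta_series_minus power2_minus E by simp
  have neg: "Re A < 0" using F3_eq_theta_series(1)[OF a z] unfolding A_def .
  have F: "F3 a t z = exp (B\<^sup>2 / (4 * A)) * theta_series A B / (exp (A / 12) * euler_prod A)"
    using F3_eq_theta_series(2)[OF a z] unfolding A_def B_def .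
  have sq: "csqrt (pi / (- A)) \<noteq> 0" using nz by simp
  have th: "theta_series A B = csqrt (pi / (- A)) * exp (- (B\<^sup>2 / (4 * A))) * theta_series A' B'"
    unfolding A'_def B'_def using theta_inversion[OF neg, of B] by simp
  have eta: "exp (A / 12) * euler_prod A = csqrt (pi / (- A)) * (exp (A' / 12) * euler_prod A')"
    unfolding A'_def by (rule eta_inversion[OF neg])
  have "exp (- \<i> * of_real pi * t^2 * z / (2 * of_real a)) = exp (- (B\<^sup>2 / (4 * A)))"
    using a nz by (intro arg_cong[of _ _ exp]) (simp add: A_def B_def field_simps power2_eq_square)
  thus ?thesis unfolding F F' th eta using sq by (simp add: exp_minus field_simps)
qed

section \<open>The exponential formula\<close>

text \<open>For m, n at least 1 one has m n >= m + n - 1, so r^(m n) is at most r^m r^n / r, a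
  product of two geometric series.\<close>

lemma summable_on_geometric_pairs:
  fixes r :: real
  assumes "0 < r" "r < 1"
  shows "(\<lambda>(m, n). r ^ (m * n)) summable_on {1..} \<times> {1..}"
proof (rule summable_on_comparison_test)
  have geo: "((\<lambda>n. r ^ n) has_sum 1 / (1 - r)) UNIV"
    using assms by (intro sums_nonneg_imp_has_sum geometric_sums) auto
  have "(\<lambda>(m, n). r ^ m * r ^ n / r) summable_on UNIV \<times> UNIV"
  proof (rule summable_on_SigmaI)
    show "((\<lambda>n. case (m, n) of (m, n) \<Rightarrow> r ^ m * r ^ n / r) has_sum r ^ m * (1 / r * (1 / (1 - r)))) UNIV" for m
      using has_sum_cmult_right[OF geo, of "r ^ m * (1 / r)"] by (simp add: mult_ac)
    show "(\<lambda>m. r ^ m * (1 / r * (1 / (1 - r)))) summable_on UNIV"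
      using geo by (intro summable_on_cmult_left) (auto simp: summable_on_def)
  qed (use assms in auto)
  thus "(\<lambda>(m, n). r ^ m * r ^ n / r) summable_on {1..} \<times> {1..}"
    by (rule summable_on_subset_banach) auto
  fix x :: "nat \<times> nat" assume "x \<in> {1..} \<times> {1..}"
  then obtain m n where x: "x = (Suc m, Suc n)"
    by (cases x) (auto simp: Suc_le_eq gr0_conv_Suc)
  have "r ^ (Suc m * Suc n) \<le> r ^ (Suc m + n)"
    using assms by (intro power_decreasing) auto
  also have "\<dots> = r ^ Suc m * r ^ Suc n / r" using assms by (simp add: power_add)
  finally show "(case x of (m, n) \<Rightarrow> r ^ (m * n)) \<le> (case x of (m, n) \<Rightarrow> r ^ m * r ^ n / r)"
    by (simp only: x prod.case)
qed (use assms in auto)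

lemma has_sum_ln_one_plus:
  fixes w :: complex
  assumes "norm w < 1"
  shows "((\<lambda>m. (-1) ^ m / of_nat m * w ^ m) has_sum - ln (1 + w)) {1..}"
proof -
  have "(\<lambda>m. (-1) ^ Suc m / of_nat m * w ^ m) sums ln (1 + w)"
    using Ln_series[OF assms] by simp
  hence "(\<lambda>m. - ((-1) ^ Suc m / of_nat m * w ^ m)) sums - ln (1 + w)"
    by (rule sums_minus)
  moreover have "- ((-1) ^ Suc m / of_nat m * w ^ m) = (-1) ^ m / of_nat m * w ^ m" for m
    by simp
  ultimately have s: "(\<lambda>m. (-1) ^ m / of_nat m * w ^ m) sums - ln (1 + w)"
    by (simp only:)
  have "summable (\<lambda>m. norm ((-1) ^ m / of_nat m * w ^ m))"
  proof (rule summable_comparison_test)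
    show "summable (\<lambda>m. norm w ^ m)" using assms by (simp add: summable_geometric)
    show "\<exists>N. \<forall>m\<ge>N. norm (norm ((-1) ^ m / of_nat m * w ^ m)) \<le> norm w ^ m"
    proof (intro exI allI impI)
      fix m :: nat
      show "norm (norm ((-1) ^ m / of_nat m * w ^ m)) \<le> norm w ^ m"
        using mult_right_mono[of 1 "real m" "norm w ^ m"]
        by (cases "m = 0") (auto simp: norm_mult norm_divide norm_power field_simps)
    qed
  qed
  \<comment> \<open>The index m = 0 may be dropped because division by zero yields 0.\<close>
  from norm_summable_imp_has_sum[OF this s]
  show ?thesis
    by (rule has_sum_cong_neutral[THEN iffD1, rotated -1]) auto
qed

text \<open>The absolutely convergent double series of (-1)^m / m q^(n m) over n in S and m >= 1 is
  summed in two ways: along rows it gives logarithms, and grouped by the product n m it gives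
  divisor sums. The shared value T expresses their equality.\<close>

lemma ln_product_divisor_sum:
  fixes q :: complex and S :: "nat set"
  assumes q: "norm q < 1" "q \<noteq> 0" and S: "0 \<notin> S"
  obtains T where "((\<lambda>n. - ln (1 + q ^ n)) has_sum T) S"
    and "((\<lambda>n. q ^ n * (\<Sum>m | m dvd n \<and> n div m \<in> S. (-1) ^ m / of_nat m)) has_sum T) {1..}"
proof -
  define f where "f = (\<lambda>(n, m). (-1) ^ m / of_nat m * (q ^ n) ^ m)"
  have Sge: "S \<subseteq> {1..}" using S by (auto simp: Suc_le_eq intro: gr0I)
  have "(\<lambda>(n, m). norm q ^ (n * m)) summable_on S \<times> {1..}"
    using summable_on_geometric_pairs[of "norm q"] q Sge
    by (rule_tac summable_on_subset_banach[of _ "{1..} \<times> {1..}"]) auto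
  hence "(\<lambda>x. norm (f x)) summable_on S \<times> {1..}"
  proof (rule summable_on_comparison_test)
    fix x assume "x \<in> S \<times> {1::nat..}"
    then obtain n m where x: "x = (n, m)" "m \<ge> 1" by auto
    have "norm (f x) = norm q ^ (n * m) / real m"
      by (simp add: f_def x norm_mult norm_divide norm_power power_mult)
    also have "\<dots> \<le> norm q ^ (n * m) / 1"
      using x(2) by (intro divide_left_mono) auto
    finally show "norm (f x) \<le> (case x of (n, m) \<Rightarrow> norm q ^ (n * m))" by (simp add: x)
  qed auto
  hence "f summable_on S \<times> {1..}" by (rule abs_summable_summable)
  then obtain T where T: "(f has_sum T) (S \<times> {1..})" by (auto simp: summable_on_def)
  have 1: "((\<lambda>n. - ln (1 + q ^ n)) has_sum T) S"
  proof (rule has_sum_SigmaD[OF T])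
    fix n assume "n \<in> S"
    hence "n \<noteq> 0" using S by metis
    hence "norm (q ^ n) < 1" using q by (simp add: norm_power power_less_one_iff)
    thus "((\<lambda>m. f (n, m)) has_sum - ln (1 + q ^ n)) {1..}"
      unfolding f_def using has_sum_ln_one_plus by simp
  qed
  define D where "D = (\<lambda>n. {m. m dvd n \<and> n div m \<in> S})"
  have "((\<lambda>(n, m). q ^ n * ((-1) ^ m / of_nat m)) has_sum T) (Sigma {1..} D)"
  \<comment> \<open>The pair (n, m) is sent to (n m, m), so the first component becomes the exponent
    of q and the second a divisor of it.\<close>
  proof (subst has_sum_reindex_bij_witness[of _ "\<lambda>(n, m). (n * m, m)" "\<lambda>(n, m). (n div m, m)" "S \<times> {1..}" f])
    show "(f has_sum T) (S \<times> {1..})" by (rule T)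
  qed (use Sge in \<open>auto simp: D_def f_def power_mult[symmetric] Suc_le_eq intro!: gr0I\<close>)
  hence 2: "((\<lambda>n. q ^ n * (\<Sum>m\<in>D n. (-1) ^ m / of_nat m)) has_sum T) {1..}"
  proof (rule has_sum_SigmaD)
    fix n :: nat assume "n \<in> {1..}"
    hence "finite {m. m dvd n}" by (intro finite_divisors_nat) auto
    hence "finite (D n)" by (rule finite_subset[rotated]) (auto simp: D_def)
    thus "((\<lambda>m. case (n, m) of (n, m) \<Rightarrow> q ^ n * ((-1) ^ m / of_nat m)) has_sum
        q ^ n * (\<Sum>m\<in>D n. (-1) ^ m / of_nat m)) (D n)"
      by (intro has_sum_finiteI) (auto simp: sum_distrib_left)
  qed
  show ?thesis using that[OF 1] 2 unfolding D_def by blast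
qed

text \<open>As 0 < t < a, the least residues of the two classes modulo 2a are a - t and a + t. The
  progressions are written around odd multiples of a, matching the exponents of the triple product;
  the natural-number subtraction never truncates because a (2k + 1) > t.\<close>

lemma cong_pm_iff:
  fixes a t n :: nat
  assumes "0 < t" "t < a"
  shows "(int n mod (2 * int a) = (int a - int t) mod (2 * int a) \<or>
          int n mod (2 * int a) = (- (int a - int t)) mod (2 * int a)) \<longleftrightarrow>
         n \<in> range (\<lambda>k. a * (2 * k + 1) + t) \<union> range (\<lambda>k. a * (2 * k + 1) - t)" (is "?L \<longleftrightarrow> ?R")
proof -
  have m1: "(int a - int t) mod (2 * int a) = int (a - t)"
    using assms by (simp add: of_nat_diff)
  have "(- (int a - int t)) mod (2 * int a) = (- (int a - int t) + 2 * int a) mod (2 * int a)"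
    by (simp only: mod_add_self2)
  also have "- (int a - int t) + 2 * int a = int (a + t)" by simp
  also have "int (a + t) mod (2 * int a) = int (a + t)" using assms by simp
  finally have m2: "(- (int a - int t)) mod (2 * int a) = int (a + t)" .
  have "int n mod (2 * int a) = int (n mod (2 * a))" by (simp add: zmod_int)
  hence L: "?L \<longleftrightarrow> n mod (2 * a) = a - t \<or> n mod (2 * a) = a + t"
    unfolding m1 m2 by (simp only: of_nat_eq_iff)
  have e1: "a * (2 * k + 1) + t = (a + t) + k * (2 * a)" for k by (simp add: algebra_simps)
  have e2: "a * (2 * k + 1) - t = (a - t) + k * (2 * a)" for k using assms by (simp add: algebra_simps)
  show ?thesis
  proof
    assume ?L
    hence "n = (a + t) + (n div (2 * a)) * (2 * a) \<or> n = (a - t) + (n div (2 * a)) * (2 * a)"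
      unfolding L using div_mult_mod_eq[of n "2 * a"] by linarith
    thus ?R unfolding e1 e2 by blast
  next
    assume ?R
    then obtain k where "n = (a + t) + k * (2 * a) \<or> n = (a - t) + k * (2 * a)"
      unfolding e1 e2 by blast
    hence "n mod (2 * a) = (a + t) mod (2 * a) \<or> n mod (2 * a) = (a - t) mod (2 * a)"
      using mod_mult_self1 by metis
    thus ?L unfolding L using assms by (simp add: mod_less) blast
  qed
qed

text \<open>For these parameters the triple product has the factors 1 + q^(a(2k+1)+t) and 1 +
  q^(a(2k+1)-t). Their exponents run through \<open>S1\<close> and \<open>S2\<close>, so
  \<open>ln_product_divisor_sum\<close> on the union evaluates the logarithm of the product.\<close>

lemma F3_exp_formula:
  fixes a t :: nat and z :: complex
  assumes t: "0 < t" "t < a" and z: "Im z > 0"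
  shows "F3 (real a) (of_nat t) z =
           ee ((- of_nat a / 12 + (of_nat t)^2 / (4 * of_nat a)) * z) *
           exp (- (\<Sum>n. (ee z) ^ Suc n * coeffF3 a t (Suc n)))"
proof -
  define q where "q = ee z"
  define A where "A = 2 * of_real pi * \<i> * of_real (real a) * z"
  define B where "B = 2 * of_real pi * \<i> * of_nat t * z"
  have a0: "real a > 0" using t by simp
  have q: "norm q < 1" "q \<noteq> 0" using z by (auto simp: q_def ee_def)
  have neg: "Re A < 0" using F3_eq_theta_series(1)[OF a0 z] unfolding A_def .
  define S1 S2 where "S1 = range (\<lambda>k. a * (2 * k + 1) + t)" and "S2 = range (\<lambda>k. a * (2 * k + 1) - t)"
  have pos: "a * (2 * k + 1) - t > 0" for k using t by (simp add: algebra_simps trans_less_add1)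
  hence "0 \<notin> S1 \<union> S2" using t unfolding S1_def S2_def by auto
  from ln_product_divisor_sum[OF q this] obtain T where
    T1: "((\<lambda>n. - ln (1 + q ^ n)) has_sum T) (S1 \<union> S2)" and
    T2: "((\<lambda>n. q ^ n * (\<Sum>m | m dvd n \<and> n div m \<in> S1 \<union> S2. (-1) ^ m / of_nat m)) has_sum T) {1..}"
    by blast
  have "coeffF3 a t n = (\<Sum>m | m dvd n \<and> n div m \<in> S1 \<union> S2. (-1) ^ m / of_nat m)" for n
    unfolding coeffF3_def cong_pm_iff[OF t] S1_def S2_def ..
  hence "((\<lambda>n. q ^ n * coeffF3 a t n) has_sum T) {1..}" using T2 by simp
  hence "((\<lambda>n. q ^ Suc n * coeffF3 a t (Suc n)) has_sum T) UNIV"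
    by (subst has_sum_reindex_bij_witness[of _ "\<lambda>n. n - 1" Suc "{1..}" "\<lambda>n. q ^ n * coeffF3 a t n"]) auto
  hence suminf: "(\<Sum>n. q ^ Suc n * coeffF3 a t (Suc n)) = T"
    using has_sum_imp_sums sums_unique by fastforce

  \<comment> \<open>A common element would make t a multiple of a, contradicting 0 < t < a.
    Disjointness and injectivity ensure that each factor of the product is counted once.\<close>
  have disj: "S1 \<inter> S2 = {}"
  proof -
    have "a * (2 * k + 1) + t \<noteq> a * (2 * l + 1) - t" for k l
    proof
      assume "a * (2 * k + 1) + t = a * (2 * l + 1) - t"
      hence "2 * (a * k + t) = 2 * (a * l)" using pos[of l] by (simp add: algebra_simps)
      hence eq: "a * k + t = a * l" by simp
      hence "(a * k + t) mod a = 0" by simp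
      thus False using t by simp
    qed
    thus ?thesis unfolding S1_def S2_def by blast
  qed
  have sub: "(\<lambda>n. - ln (1 + q ^ n)) summable_on S" if "S \<subseteq> S1 \<union> S2" for S
    using summable_on_subset_banach[OF _ that] T1 summable_on_def by blast
  obtain T3 T4 where T3: "((\<lambda>n. - ln (1 + q ^ n)) has_sum T3) S1" and T4: "((\<lambda>n. - ln (1 + q ^ n)) has_sum T4) S2"
    using sub[of S1] sub[of S2] unfolding summable_on_def by auto
  have T: "T = T3 + T4"
    using has_sum_unique[OF T1 has_sum_Un_disjoint[OF T3 T4 disj]] .
  have inj: "inj (\<lambda>k. a * (2 * k + 1) + t)" "inj (\<lambda>k. a * (2 * k + 1) - t)"
  proof -
    show "inj (\<lambda>k. a * (2 * k + 1) + t)" using t by (auto simp: inj_on_def)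
    show "inj (\<lambda>k. a * (2 * k + 1) - t)"
    proof (rule injI)
      fix k l assume "a * (2 * k + 1) - t = a * (2 * l + 1) - t"
      hence "a * (2 * k + 1) = a * (2 * l + 1)" using pos[of k] pos[of l] by linarith
      thus "k = l" using t by simp
    qed
  qed
  have "((\<lambda>k. - ln (1 + q ^ (a * (2 * k + 1) + t))) has_sum T3) UNIV"
    using T3 unfolding S1_def by (subst (asm) has_sum_reindex[OF inj(1)]) (simp add: o_def)
  moreover have "((\<lambda>k. - ln (1 + q ^ (a * (2 * k + 1) - t))) has_sum T4) UNIV"
    using T4 unfolding S2_def by (subst (asm) has_sum_reindex[OF inj(2)]) (simp add: o_def)
  ultimately have "(\<lambda>k. - ln (1 + q ^ (a * (2 * k + 1) + t)) + - ln (1 + q ^ (a * (2 * k + 1) - t))) sums T"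
    unfolding T by (intro sums_add has_sum_imp_sums)
  \<comment> \<open>Exponentiating the partial sums avoids any choice of branch: only exp (ln (1 +
    q^m)) = 1 + q^m is used, which holds as |q^m| < 1.\<close>
  hence "(\<lambda>N. exp (- (\<Sum>k<N. - ln (1 + q ^ (a * (2 * k + 1) + t)) + - ln (1 + q ^ (a * (2 * k + 1) - t))))) \<longlonglongrightarrow> exp (- T)"
    unfolding sums_def by (intro tendsto_intros)
  moreover have "exp (- (\<Sum>k<N. - ln (1 + q ^ (a * (2 * k + 1) + t)) + - ln (1 + q ^ (a * (2 * k + 1) - t)))) =
      (\<Prod>k<N. (1 + exp (A * (2 * of_nat k + 1) + B)) * (1 + exp (A * (2 * of_nat k + 1) - B)))" for N
  proof -
    have nz: "1 + q ^ m \<noteq> 0" if "m > 0" for m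
    proof
      assume "1 + q ^ m = 0"
      hence "norm (q ^ m) = 1" by (metis add.inverse_unique norm_minus_cancel norm_one)
      thus False using q(1) that power_strict_mono[of "norm q" 1 m] by (simp add: norm_power)
    qed
    have pow: "q ^ m = exp (of_nat m * (2 * of_real pi * \<i> * z))" for m
      unfolding q_def ee_def by (simp add: exp_of_nat_mult)
    have p1: "q ^ (a * (2 * k + 1) + t) = exp (A * (2 * of_nat k + 1) + B)" for k
      unfolding pow A_def B_def by (intro arg_cong[of _ _ exp]) (simp add: algebra_simps)
    have p2: "q ^ (a * (2 * k + 1) - t) = exp (A * (2 * of_nat k + 1) - B)" for k
    proof -
      have "t \<le> a * (2 * k + 1)" using pos[of k] by linarith
      thus ?thesis
        unfolding pow A_def B_def by (intro arg_cong[of _ _ exp]) (simp add: of_nat_diff algebra_simps)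
    qed
    have e1: "- (\<Sum>k<N. - ln (1 + q ^ (a * (2 * k + 1) + t)) + - ln (1 + q ^ (a * (2 * k + 1) - t))) =
        (\<Sum>k<N. ln (1 + q ^ (a * (2 * k + 1) + t)) + ln (1 + q ^ (a * (2 * k + 1) - t)))"
      by (simp add: sum_negf[symmetric] add.commute)
    have e2: "exp (ln (1 + q ^ (a * (2 * k + 1) + t)) + ln (1 + q ^ (a * (2 * k + 1) - t))) =
        (1 + q ^ (a * (2 * k + 1) + t)) * (1 + q ^ (a * (2 * k + 1) - t))" for k
      using exp_Ln[OF nz[of "a * (2 * k + 1) + t"]] exp_Ln[OF nz[OF pos[of k]]] t
      by (simp only: exp_add add_gr_0 simp_thms)
    show ?thesis unfolding e1 exp_sum[OF finite_lessThan] e2 unfolding p1 p2 ..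
  qed
  ultimately have "(\<lambda>N. \<Prod>k<N. (1 + exp (A * (2 * of_nat k + 1) + B)) * (1 + exp (A * (2 * of_nat k + 1) - B)))
      \<longlonglongrightarrow> exp (- T)" by (simp only:)
  hence lim: "theta_series A B / euler_prod A = exp (- T)"
    by (rule LIMSEQ_unique[OF jacobi_triple_product[OF neg]])
  have z0: "z \<noteq> 0" using z by auto
  have pref: "ee ((- of_nat a / 12 + (of_nat t)^2 / (4 * of_nat a)) * z) = exp (B\<^sup>2 / (4 * A)) / exp (A / 12)"
    unfolding exp_diff[symmetric] ee_def A_def B_def using a0 z0
    by (intro arg_cong[of _ _ exp]) (simp add: field_simps power2_eq_square)
  have "F3 (real a) (of_nat t) z = exp (B\<^sup>2 / (4 * A)) * theta_series A B / (exp (A / 12) * euler_prod A)"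
    unfolding A_def B_def by (rule F3_eq_theta_series(2)[OF a0 z])
  also have "\<dots> = exp (B\<^sup>2 / (4 * A)) / exp (A / 12) * (theta_series A B / euler_prod A)"
    by simp
  finally show ?thesis
    unfolding lim pref suminf[symmetric] q_def .
qed

theorem theorem13:
  shows "(\<forall>(a::nat) (t::nat) (z::complex). 0 < t \<and> t < a \<and> Im z > 0 \<longrightarrow>
            F3 (real a) (of_nat t) z =
              ee ((- of_nat a / 12 + (of_nat t)^2 / (4 * of_nat a)) * z) *
              exp (- (\<Sum>n. (ee z) ^ Suc n * coeffF3 a t (Suc n))))
       \<and> (\<forall>(a::real) (t::complex) (z::complex). a > 0 \<and> Im z > 0 \<longrightarrow>
            F3 (1 / a) (2 * t * z / of_real a) (- 1 / (4 * z)) =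
              exp (- \<i> * of_real pi * t^2 * z / (2 * of_real a)) * F3 a t z)"
  by (intro conjI allI impI; elim conjE; (rule F3_exp_formula | rule F3_inversion); assumption)



end
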